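(* Let $\mathbb{K}$ be a field, $d\ge 0$ an integer, $\mathcal{A}$ a $\mathbb{K}$-algebra isomorphic to $\mathrm{Mat}_{d+1}(\mathbb{K})$, and let $\Phi=(A;\{E_i\}_{i=0}^d;A^*;\{E^*_i\}_{i=0}^d)$ be a Leonard system in $\mathcal{A}$ with parameter array $(\{\theta_i\}_{i=0}^d;\{\theta^*_i\}_{i=0}^d;\{\varphi_i\}_{i=1}^d;\{\phi_i\}_{i=1}^d)$. Let $\tau_i,\eta_i,\tau^*_i,\eta^*_i$ $(0\le i\le d)$ be the polynomials attached to $\Phi$. Then for $0\le i\le d$ all of the following hold: $$\eta_i(A)E^*_0E_0=\frac{\phi_1\phi_2\cdots\phi_i}{\eta^*_d(\theta^*_0)}\,\eta^*_{d-i}(A^* )E_0,$$ $$\eta_i(A)E^*_dE_0=\frac{\varphi_d\varphi_{d-1}\cdots\varphi_{d-i+1}}{\tau^*_d(\theta^*_d)}\,\tau^*_{d-i}(A^* )E_0,$$ $$\tau_i(A)E^*_0E_d=\frac{\varphi_1\varphi_2\cdots\varphi_i}{\eta^*_d(\theta^*_0)}\,\eta^*_{d-i}(A^* )E_d,$$ $$\tau_i(A)E^*_dE_d=\frac{\phi_d\phi_{d-1}\cdots\phi_{d-i+1}}{\tau^*_d(\theta^*_d)}\,\tau^*_{d-i}(A^* )E_d,$$ $$\eta^*_i(A^* )E_0E^*_0=\frac{\phi_d\phi_{d-1}\cdots\phi_{d-i+1}}{\eta_d(\theta_0)}\,\eta_{d-i}(A)E^*_0,$$ $$\eta^*_i(A^*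 )E_dE^*_0=\frac{\varphi_d\varphi_{d-1}\cdots\varphi_{d-i+1}}{\tau_d(\theta_d)}\,\tau_{d-i}(A)E^*_0,$$ $$\tau^*_i(A^* )E_0E^*_d=\frac{\varphi_1\varphi_2\cdots\varphi_i}{\eta_d(\theta_0)}\,\eta_{d-i}(A)E^*_d,$$ $$\tau^*_i(A^* )E_dE^*_d=\frac{\phi_1\phi_2\cdots\phi_i}{\tau_d(\theta_d)}\,\tau_{d-i}(A)E^*_d.$$
   Context: Notation: $A^*$ is just the name of an element (not the conjugate-transpose of $A$). Empty products equal $1$. $V$ denotes a simple $\mathcal{A}$-module (unique up to isomorphism, of dimension $d+1$ over $\mathbb{K}$). Primitive idempotents. An element $A\in\mathcal{A}$ is multiplicity-free if it has $d+1$ mutually distinct eigenvalues in $\mathbb{K}$. If $\theta_0,\dots,\theta_d$ is an ordering of these eigenvalues, the primitive idempotent of $A$ associated with $\theta_i$ is $E_i=\prod_{0\le j\le d,\ j\ne i}\frac{A-\theta_jI}{\theta_i-\theta_j}$. Leonard system. A Leonard system in $\mathcal{A}$ is a sequence $\Phi=(A;\{E_i\}_{i=0}^d;A^*;\{E^*_i\}_{i=0}^d)$ such that: (i) $A,A^*\in\mathcal{A}$ are both multiplicity-free; (ii) $E_0,\dots,E_d$ is an ordering of the primitive idempotents of $A$; (iii) $E^*_0,\dots,E^*_d$ is an ordering of the primitive idempotents of $A^*$; (iv) for $0\le i,j\le d$, $E_iA^*E_j=0$ if $|i-j|>1$ and $E_iA^*E_j\neq0$ if $|i-j|=1$; (v)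 for $0\le i,j\le d$, $E^*_iAE^*_j=0$ if $|i-j|>1$ and $E^*_iAE^*_j\ne0$ if $|i-j|=1$. Parameter array. $\theta_i$ is the eigenvalue of $A$ associated with $E_i$, and $\theta^*_i$ is the eigenvalue of $A^*$ associated with $E^*_i$. For $0\le i\le d$ put $U_i=(E^*_0V+\cdots+E^*_iV)\cap(E_iV+\cdots+E_dV)$. It is known that each $U_i$ is $1$-dimensional, $V=U_0\oplus\cdots\oplus U_d$, $(A-\theta_iI)U_i=U_{i+1}$ $(0\le i\le d-1)$, $(A-\theta_dI)U_d=0$, $(A^*-\theta^*_iI)U_i=U_{i-1}$ $(1\le i\le d)$, $(A^*-\theta^*_0I)U_0=0$. For $1\le i\le d$, $\varphi_i$ denotes the (nonzero) eigenvalue of $(A-\theta_{i-1}I)(A^*-\theta^*_iI)$ on $U_i$; $\varphi_1,\dots,\varphi_d$ is the first split sequence of $\Phi$. The sequence $\Phi^{\Downarrow}=(A;\{E_{d-i}\}_{i=0}^d;A^*;\{E^*_i\}_{i=0}^d)$ is also a Leonard system, and the second split sequence $\phi_1,\dots,\phi_d$ of $\Phi$ is the first split sequence of $\Phi^{\Downarrow}$; that is, $\phi_i$ is the (nonzero) eigenvalue of $(A-\theta_{d-i+1}I)(A^*-\theta^*_iI)$ on $(E^*_0V+\cdots+E^*_iV)\cap(E_{d-i}V+E_{d-i-1}V+\cdots+E_0V)$. The parameter array of $\Phi$ is $(\{\theta_i\}_{i=0}^d;\{\theta^*_i\}_{i=0}^d;\{\varphi_i\}_{i=1}^d;\{\phi_i\}_{i=1}^d)$.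 Polynomials. For $0\le i\le d$, in $\mathbb{K}[\lambda]$: $\tau_i=(\lambda-\theta_0)(\lambda-\theta_1)\cdots(\lambda-\theta_{i-1})$, $\eta_i=(\lambda-\theta_d)(\lambda-\theta_{d-1})\cdots(\lambda-\theta_{d-i+1})$, $\tau^*_i=(\lambda-\theta^*_0)(\lambda-\theta^*_1)\cdots(\lambda-\theta^*_{i-1})$, $\eta^*_i=(\lambda-\theta^*_d)(\lambda-\theta^*_{d-1})\cdots(\lambda-\theta^*_{d-i+1})$. *)

theory Defs
  imports
    "HOL-Computational_Algebra.Polynomial"
    "HOL-Library.Set_Algebras"
    "Jordan_Normal_Form.Matrix"
begin

text \<open>
  The algebra is a type of class \<^class>\<open>ring_1\<close>, with the scalar multiplication by the field
  given explicitly. Indexed families are functions on \<^typ>\<open>nat\<close>, of which only the values at the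
  indices \<open>0, \<dots>, d\<close> (resp. \<open>1, \<dots>, d\<close>) matter. The letters \<open>As\<close>, \<open>Es\<close>, \<open>\<theta>s\<close>
  stand for the starred objects; \<open>vphi\<close> is the first and \<open>phi\<close> the second split sequence.
\<close>

locale assoc_algebra = vector_space scale
  for scale :: "'k::field \<Rightarrow> 'a::ring_1 \<Rightarrow> 'a" +
  assumes scale_mult_left: "scale c x * y = scale c (x * y)"
    and scale_mult_right: "x * scale c y = scale c (x * y)"

definition matrix_algebra_iso ::
    "('k::field \<Rightarrow> 'a::ring_1 \<Rightarrow> 'a) \<Rightarrow> nat \<Rightarrow> ('a \<Rightarrow> 'k mat) \<Rightarrow> bool" where
  "matrix_algebra_iso scale n f \<longleftrightarrow>
     bij_betw f UNIV (carrier_mat n n) \<and>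
     f 1 = 1\<^sub>m n \<and>
     (\<forall>x y. f (x + y) = f x + f y) \<and>
     (\<forall>x y. f (x * y) = f x * f y) \<and>
     (\<forall>c x. f (scale c x) = c \<cdot>\<^sub>m f x)"

locale matrix_algebra = assoc_algebra scale
  for scale :: "'k::field \<Rightarrow> 'a::ring_1 \<Rightarrow> 'a" and d :: nat +
  assumes iso_Mat: "\<exists>f. matrix_algebra_iso scale (Suc d) f"

locale simple_left_module =
  fixes act :: "'a::ring_1 \<Rightarrow> 'v::ab_group_add \<Rightarrow> 'v"
  assumes act_add_right: "act x (v + w) = act x v + act x w"
    and act_add_left: "act (x + y) v = act x v + act y v"
    and act_mult: "act (x * y) v = act x (act y v)"
    and act_one: "act 1 v = v"
    and nontrivial: "\<exists>v::'v. v \<noteq> 0"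
    and simple: "\<lbrakk>0 \<in> W; \<And>v w. v \<in> W \<Longrightarrow> w \<in> W \<Longrightarrow> v + w \<in> W; \<And>x v. v \<in> W \<Longrightarrow> act x v \<in> W\<rbrakk>
      \<Longrightarrow> W = {0} \<or> W = UNIV"

text \<open>
  A scalar \<open>c\<close> of the field acts on the module as the element \<open>scale c 1\<close> of the algebra.
\<close>

definition eigenvalue_on ::
    "('k::field \<Rightarrow> 'a::ring_1 \<Rightarrow> 'a) \<Rightarrow> ('a \<Rightarrow> 'v::ab_group_add \<Rightarrow> 'v) \<Rightarrow> 'v set \<Rightarrow> 'a \<Rightarrow> 'k \<Rightarrow> bool" where
  "eigenvalue_on scale act W X c \<longleftrightarrow> (\<exists>v\<in>W. v \<noteq> 0 \<and> act X v = act (scale c 1) v)"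

definition eigenvalues ::
    "('k::field \<Rightarrow> 'a::ring_1 \<Rightarrow> 'a) \<Rightarrow> ('a \<Rightarrow> 'v::ab_group_add \<Rightarrow> 'v) \<Rightarrow> 'a \<Rightarrow> 'k set" where
  "eigenvalues scale act X = {c. eigenvalue_on scale act UNIV X c}"

definition multiplicity_free ::
    "('k::field \<Rightarrow> 'a::ring_1 \<Rightarrow> 'a) \<Rightarrow> nat \<Rightarrow> ('a \<Rightarrow> 'v::ab_group_add \<Rightarrow> 'v) \<Rightarrow> 'a \<Rightarrow> bool" where
  "multiplicity_free scale d act X \<longleftrightarrow> card (eigenvalues scale act X) = d + 1"

text \<open>
  The factors commute, but the algebra does not, so the product is written as a product over a list.
\<close>

definition primitive_idempotent ::
    "('k::field \<Rightarrow> 'a::ring_1 \<Rightarrow> 'a) \<Rightarrow> nat \<Rightarrow> 'a \<Rightarrow> (nat \<Rightarrow> 'k) \<Rightarrow> nat \<Rightarrow> 'a" where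
  "primitive_idempotent scale d X \<theta> i =
     prod_list (map (\<lambda>j. scale (1 / (\<theta> i - \<theta> j)) (X - scale (\<theta> j) 1))
       (filter (\<lambda>j. j \<noteq> i) [0..<Suc d]))"

text \<open>
  \<open>E\<close> is an ordering of the primitive idempotents of \<open>X\<close>, with \<open>\<theta> i\<close> the eigenvalue of \<open>X\<close>
  associated with \<open>E i\<close>.
\<close>

definition idempotent_ordering ::
    "('k::field \<Rightarrow> 'a::ring_1 \<Rightarrow> 'a) \<Rightarrow> nat \<Rightarrow> ('a \<Rightarrow> 'v::ab_group_add \<Rightarrow> 'v)
      \<Rightarrow> 'a \<Rightarrow> (nat \<Rightarrow> 'a) \<Rightarrow> (nat \<Rightarrow> 'k) \<Rightarrow> bool" where
  "idempotent_ordering scale d act X E \<theta> \<longleftrightarrow>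
     bij_betw \<theta> {..d} (eigenvalues scale act X) \<and>
     (\<forall>i\<le>d. E i = primitive_idempotent scale d X \<theta> i)"

definition leonard_system ::
    "('k::field \<Rightarrow> 'a::ring_1 \<Rightarrow> 'a) \<Rightarrow> nat \<Rightarrow> ('a \<Rightarrow> 'v::ab_group_add \<Rightarrow> 'v)
      \<Rightarrow> 'a \<Rightarrow> (nat \<Rightarrow> 'a) \<Rightarrow> 'a \<Rightarrow> (nat \<Rightarrow> 'a) \<Rightarrow> bool" where
  "leonard_system scale d act A E As Es \<longleftrightarrow>
     multiplicity_free scale d act A \<and> multiplicity_free scale d act As \<and>
     (\<exists>\<theta>. idempotent_ordering scale d act A E \<theta>) \<and>
     (\<exists>\<theta>s. idempotent_ordering scale d act As Es \<theta>s) \<and>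
     (\<forall>i\<le>d. \<forall>j\<le>d.
        (\<bar>int i - int j\<bar> > 1 \<longrightarrow> E i * As * E j = 0) \<and>
        (\<bar>int i - int j\<bar> = 1 \<longrightarrow> E i * As * E j \<noteq> 0)) \<and>
     (\<forall>i\<le>d. \<forall>j\<le>d.
        (\<bar>int i - int j\<bar> > 1 \<longrightarrow> Es i * A * Es j = 0) \<and>
        (\<bar>int i - int j\<bar> = 1 \<longrightarrow> Es i * A * Es j \<noteq> 0))"

text \<open>The sums are sums of subsets of the module, and \<open>range (act (E j))\<close> is the subspace \<open>E\<^sub>j V\<close>.\<close>

definition split_space ::
    "nat \<Rightarrow> ('a::ring_1 \<Rightarrow> 'v::ab_group_add \<Rightarrow> 'v) \<Rightarrow> (nat \<Rightarrow> 'a) \<Rightarrow> (nat \<Rightarrow> 'a) \<Rightarrow> nat \<Rightarrow> 'v set" where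
  "split_space d act E Es i =
     (\<Sum>j\<in>{0..i}. range (act (Es j))) \<inter> (\<Sum>j\<in>{i..d}. range (act (E j)))"

definition first_split_sequence ::
    "('k::field \<Rightarrow> 'a::ring_1 \<Rightarrow> 'a) \<Rightarrow> nat \<Rightarrow> ('a \<Rightarrow> 'v::ab_group_add \<Rightarrow> 'v)
      \<Rightarrow> 'a \<Rightarrow> (nat \<Rightarrow> 'a) \<Rightarrow> (nat \<Rightarrow> 'k) \<Rightarrow> 'a \<Rightarrow> (nat \<Rightarrow> 'a) \<Rightarrow> (nat \<Rightarrow> 'k) \<Rightarrow> (nat \<Rightarrow> 'k) \<Rightarrow> bool" where
  "first_split_sequence scale d act A E \<theta> As Es \<theta>s vphi \<longleftrightarrow>
     (\<forall>i\<in>{1..d}. eigenvalue_on scale act (split_space d act E Es i)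
        ((A - scale (\<theta> (i - 1)) 1) * (As - scale (\<theta>s i) 1)) (vphi i))"

text \<open>
  The second split sequence is the first split sequence of the system with the ordering of the
  \<open>E\<^sub>i\<close> (hence of the \<open>\<theta>\<^sub>i\<close>) inverted.
\<close>

definition parameter_array ::
    "('k::field \<Rightarrow> 'a::ring_1 \<Rightarrow> 'a) \<Rightarrow> nat \<Rightarrow> ('a \<Rightarrow> 'v::ab_group_add \<Rightarrow> 'v)
      \<Rightarrow> 'a \<Rightarrow> (nat \<Rightarrow> 'a) \<Rightarrow> 'a \<Rightarrow> (nat \<Rightarrow> 'a)
      \<Rightarrow> (nat \<Rightarrow> 'k) \<Rightarrow> (nat \<Rightarrow> 'k) \<Rightarrow> (nat \<Rightarrow> 'k) \<Rightarrow> (nat \<Rightarrow> 'k) \<Rightarrow> bool" where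
  "parameter_array scale d act A E As Es \<theta> \<theta>s vphi phi \<longleftrightarrow>
     idempotent_ordering scale d act A E \<theta> \<and>
     idempotent_ordering scale d act As Es \<theta>s \<and>
     first_split_sequence scale d act A E \<theta> As Es \<theta>s vphi \<and>
     first_split_sequence scale d act A (\<lambda>i. E (d - i)) (\<lambda>i. \<theta> (d - i)) As Es \<theta>s phi"

definition tau_poly :: "(nat \<Rightarrow> 'k::field) \<Rightarrow> nat \<Rightarrow> 'k poly" where
  "tau_poly \<theta> i = (\<Prod>j<i. [:- \<theta> j, 1:])"

definition eta_poly :: "nat \<Rightarrow> (nat \<Rightarrow> 'k::field) \<Rightarrow> nat \<Rightarrow> 'k poly" where
  "eta_poly d \<theta> i = (\<Prod>j<i. [:- \<theta> (d - j), 1:])"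

definition eval_poly :: "('k::field \<Rightarrow> 'a::ring_1 \<Rightarrow> 'a) \<Rightarrow> 'k poly \<Rightarrow> 'a \<Rightarrow> 'a" where
  "eval_poly scale p X = (\<Sum>k\<le>degree p. scale (coeff p k) (X ^ k))"

end

theory Submission
  imports Defs
begin

text \<open>
  All eight identities are one identity, applied to eight Leonard systems. For the system \<open>\<Phi>\<close> put
  \<open>U\<^sub>i = (E*\<^sub>0V + \<dots> + E*\<^sub>iV) \<inter> (E\<^sub>iV + \<dots> + E\<^sub>dV)\<close> and take \<open>v \<in> E\<^sub>dV\<close>. Up to the factor \<open>\<eta>*\<^sub>d(\<theta>*\<^sub>0)\<close>, the
  projection \<open>E*\<^sub>0\<close> is \<open>\<eta>*\<^sub>d(A*) = (A* - \<theta>*\<^sub>1) \<dots> (A* - \<theta>*\<^sub>d)\<close>. Since \<open>v \<in> U\<^sub>d\<close> and \<open>A* - \<theta>*\<^sub>k\<close> lowers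
  \<open>U\<^sub>k\<close> to \<open>U\<^sub>k\<^sub>-\<^sub>1\<close>, the partial product \<open>\<eta>*\<^sub>d\<^sub>-\<^sub>i(A*) v\<close> lies in \<open>U\<^sub>i\<close>. In the product
  \<open>\<tau>\<^sub>i(A) (A* - \<theta>*\<^sub>1) \<dots> (A* - \<theta>*\<^sub>i) \<eta>*\<^sub>d\<^sub>-\<^sub>i(A*) v\<close> the innermost pair \<open>(A - \<theta>\<^sub>0)(A* - \<theta>*\<^sub>1)\<close> acts on \<open>U\<^sub>1\<close>
  as \<open>\<phi>\<^sub>1\<close>, then \<open>(A - \<theta>\<^sub>1)(A* - \<theta>*\<^sub>2)\<close> acts on \<open>U\<^sub>2\<close> as \<open>\<phi>\<^sub>2\<close>, and so on; \<open>\<phi>\<^sub>1 \<dots> \<phi>\<^sub>i\<close> comes out. This is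
  \<open>shifted_product_split\<close>, the third identity of the list. That \<open>(A - \<theta>\<^sub>i\<^sub>-\<^sub>1)(A* - \<theta>*\<^sub>i)\<close> is a scalar on
  \<open>U\<^sub>i\<close> holds because \<open>U\<^sub>i\<close> has dimension one, which follows from \<open>opposite_flags\<close>.

  The other identities arise by reversing the order of the \<open>E\<^sub>i\<close>, reversing the order of the \<open>E*\<^sub>i\<close>
  and exchanging \<open>A\<close> with \<open>A*\<close>. What has to be known is how the scalars \<open>\<phi>\<^sub>i\<close> change.
  \<^item> Reversing the \<open>E\<^sub>i\<close> turns the first split sequence into the second, by definition.
  \<^item> Reversing both and exchanging \<open>A\<close> with \<open>A*\<close> keeps the spaces \<open>U\<^sub>i\<close> and the scalars, both in
    opposite order (\<open>split_scalars_dual\<close>): raising by \<open>A - \<theta>\<^sub>i\<close> and then lowering in \<open>U\<^sub>i\<close> gives the same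
    scalar as lowering and then raising in \<open>U\<^sub>i\<^sub>+\<^sub>1\<close>.
  \<^item> Reversing both without the exchange also puts the scalars in opposite order
    (\<open>split_scalars_both_reversed\<close>), although the spaces \<open>U\<^sub>i\<close> become different ones. The reason is that
    the number \<open>a\<^sub>j\<close> with \<open>E*\<^sub>j A E*\<^sub>j = a\<^sub>j E*\<^sub>j\<close> is
    \<open>\<theta>\<^sub>j + \<phi>\<^sub>j\<^sub>+\<^sub>1 / (\<theta>*\<^sub>j - \<theta>*\<^sub>j\<^sub>+\<^sub>1) + \<phi>\<^sub>j / (\<theta>*\<^sub>j - \<theta>*\<^sub>j\<^sub>-\<^sub>1)\<close>, where terms with an index out of range are
    absent (\<open>proj_op_proj\<close>). These numbers determine all \<open>\<phi>\<^sub>j\<close> recursively, and they are common to the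
    two systems.

  All this takes place in the module \<open>V\<close>. It transfers to the algebra because the module is faithful
  (\<open>faithful\<close>) and is spanned by \<open>d + 1\<close> vectors (\<open>finite_spanning_set\<close>): thus the eigenvectors of a
  multiplicity-free element form a basis, and its primitive idempotents act as the projections onto
  the lines that they span.
\<close>

section \<open>Operators with a resolution of the identity\<close>

text \<open>
  The operator has the mutually distinct eigenvalues \<open>\<theta>\<^sub>0, \<dots>, \<theta>\<^sub>d\<close>, each with a one-dimensional
  eigenspace, and \<open>P\<^sub>i\<close> is the projection onto the \<open>i\<close>-th eigenspace along the sum of the others.
\<close>

locale eigen_resolution = op: Vector_Spaces.linear sc sc X
  for sc :: "'k::field \<Rightarrow> 'v::ab_group_add \<Rightarrow> 'v" (infixr "\<cdot>" 75) and X :: "'v \<Rightarrow> 'v" +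
  fixes d :: nat and P :: "nat \<Rightarrow> 'v \<Rightarrow> 'v" and \<theta> :: "nat \<Rightarrow> 'k"
  assumes proj_linear: "i \<le> d \<Longrightarrow> Vector_Spaces.linear sc sc (P i)"
    and proj_proj: "i \<le> d \<Longrightarrow> j \<le> d \<Longrightarrow> P i (P j x) = (if i = j then P j x else 0)"
    and proj_sum: "(\<Sum>j\<le>d. P j x) = x"
    and op_proj: "j \<le> d \<Longrightarrow> X (P j x) = \<theta> j \<cdot> P j x"
    and proj_nonzero: "j \<le> d \<Longrightarrow> \<exists>x. P j x \<noteq> 0"
    and proj_rank_one: "j \<le> d \<Longrightarrow> P j x \<noteq> 0 \<Longrightarrow> \<exists>c. P j y = c \<cdot> P j x"
    and \<theta>_inj: "inj_on \<theta> {..d}"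
begin

lemma proj_simps:
  assumes "i \<le> d"
  shows "P i (x + y) = P i x + P i y" "P i (x - y) = P i x - P i y"
    "P i (c \<cdot> x) = c \<cdot> P i x" "P i 0 = 0" "P i (sum g J) = (\<Sum>j\<in>J. P i (g j))"
proof -
  interpret p: Vector_Spaces.linear sc sc "P i" using proj_linear[OF assms] .
  show "P i (x + y) = P i x + P i y" "P i (x - y) = P i x - P i y"
    "P i (c \<cdot> x) = c \<cdot> P i x" "P i 0 = 0" "P i (sum g J) = (\<Sum>j\<in>J. P i (g j))"
    by (rule p.add p.diff p.scale p.zero p.sum)+
qed

lemma proj_op:
  assumes "i \<le> d" shows "P i (X x) = \<theta> i \<cdot> P i x"
proof -
  have "P i (X x) = P i (X (\<Sum>j\<le>d. P j x))" by (simp add: proj_sum)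
  also have "\<dots> = (\<Sum>j\<le>d. \<theta> j \<cdot> (if i = j then P j x else 0))"
    using assms by (simp add: op.sum proj_simps op_proj proj_proj)
  also have "\<dots> = (\<Sum>j\<le>d. if j = i then \<theta> j \<cdot> P j x else 0)"
    by (rule sum.cong) auto
  also have "\<dots> = \<theta> i \<cdot> P i x" using assms by simp
  finally show ?thesis .
qed

lemma eq_zero_if_projs_zero:
  assumes "\<And>j. j \<le> d \<Longrightarrow> P j x = 0" shows "x = 0"
  using proj_sum[of x] assms by simp

lemma linear_expand:
  assumes "Vector_Spaces.linear sc sc Y" "k \<le> d"
  shows "P k (Y x) = (\<Sum>j\<le>d. P k (Y (P j x)))"
proof -
  interpret y: Vector_Spaces.linear sc sc Y by fact
  have "P k (Y x) = P k (Y (\<Sum>j\<le>d. P j x))" by (simp add: proj_sum)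
  then show ?thesis using assms by (simp add: y.sum proj_simps)
qed

lemma reversed: "eigen_resolution sc X d (\<lambda>i. P (d - i)) (\<lambda>i. \<theta> (d - i))"
proof unfold_locales
  show "(\<Sum>j\<le>d. P (d - j) x) = x" for x
  proof -
    have "(\<Sum>j\<le>d. P (d - j) x) = (\<Sum>j\<le>d. P j x)"
      by (rule sum.reindex_bij_witness[where i = "\<lambda>j. d - j" and j = "\<lambda>j. d - j"]) auto
    then show ?thesis by (simp add: proj_sum)
  qed
  show "inj_on (\<lambda>i. \<theta> (d - i)) {..d}"
    by (rule inj_onI, drule inj_onD[OF \<theta>_inj]) auto
qed (auto simp: proj_proj op_proj proj_nonzero proj_rank_one intro: linear.axioms proj_linear
   simp: linear_def[symmetric] proj_simps)

end

text \<open>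
  This is \<open>(X - r\<^sub>n\<^sub>-\<^sub>1) \<dots> (X - r\<^sub>0) x\<close>; for \<open>r = \<theta>\<close> it is \<open>\<tau>\<^sub>n(X) x\<close>, and for \<open>r\<^sub>j = \<theta>\<^sub>d\<^sub>-\<^sub>j\<close> it is \<open>\<eta>\<^sub>n(X) x\<close>.
\<close>

primrec shifted_product ::
    "('k \<Rightarrow> 'v \<Rightarrow> 'v) \<Rightarrow> ('v \<Rightarrow> 'v) \<Rightarrow> (nat \<Rightarrow> 'k::field) \<Rightarrow> nat \<Rightarrow> 'v::ab_group_add \<Rightarrow> 'v" where
  "shifted_product sc X r 0 x = x"
| "shifted_product sc X r (Suc n) x =
     X (shifted_product sc X r n x) - sc (r n) (shifted_product sc X r n x)"

context eigen_resolution
begin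

lemma proj_shifted_product:
  assumes "i \<le> d"
  shows "P i (shifted_product sc X r n x) = (\<Prod>j<n. \<theta> i - r j) \<cdot> P i x"
  by (induction n)
    (use assms in \<open>simp_all add: proj_simps proj_op op.vs1.scale_left_diff_distrib[symmetric] left_diff_distrib mult.commute\<close>)

lemma shifted_product_scale:
  "shifted_product sc X r n (c \<cdot> x) = c \<cdot> shifted_product sc X r n x"
  by (induction n) (simp_all add: op.scale op.vs1.scale_right_diff_distrib mult.commute)

end

section \<open>Leonard systems of operators\<close>

text \<open>
  The conditions \<open>irred\<close> speak of all vectors not killed by \<open>E\<^sub>j\<close>, instead of stating that an operator
  is nonzero. For projections of rank one this is the same, and it is what gets applied.
\<close>

locale leonard_action =
  a: eigen_resolution sc A d E \<theta> + s: eigen_resolution sc As d Es \<theta>s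
  for sc :: "'k::field \<Rightarrow> 'v::ab_group_add \<Rightarrow> 'v" (infixr "\<cdot>" 75)
    and d :: nat and A E \<theta> As Es \<theta>s +
  assumes tridiag: "i \<le> d \<Longrightarrow> j \<le> d \<Longrightarrow> i + 1 < j \<or> j + 1 < i \<Longrightarrow> E i (As (E j x)) = 0"
    and tridiag_star: "i \<le> d \<Longrightarrow> j \<le> d \<Longrightarrow> i + 1 < j \<or> j + 1 < i \<Longrightarrow> Es i (A (Es j x)) = 0"
    and irred: "i \<le> d \<Longrightarrow> j \<le> d \<Longrightarrow> i = j + 1 \<or> j = i + 1 \<Longrightarrow> E j x \<noteq> 0 \<Longrightarrow> E i (As (E j x)) \<noteq> 0"
    and irred_star: "i \<le> d \<Longrightarrow> j \<le> d \<Longrightarrow> i = j + 1 \<or> j = i + 1 \<Longrightarrow> Es j x \<noteq> 0 \<Longrightarrow> Es i (A (Es j x)) \<noteq> 0"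

lemma (in leonard_action) starred: "leonard_action sc d As Es \<theta>s A E \<theta>"
  using tridiag tridiag_star irred irred_star by unfold_locales auto

lemma (in leonard_action) reversed:
  "leonard_action sc d A (\<lambda>i. E (d - i)) (\<lambda>i. \<theta> (d - i)) As Es \<theta>s"
proof -
  interpret r: eigen_resolution sc A d "\<lambda>i. E (d - i)" "\<lambda>i. \<theta> (d - i)" by (rule a.reversed)
  show ?thesis
  proof unfold_locales
    fix i j x assume ij: "i \<le> d" "j \<le> d"
    show "i + 1 < j \<or> j + 1 < i \<Longrightarrow> E (d - i) (As (E (d - j) x)) = 0"
      by (rule tridiag) (use ij in arith)+
    show "i = j + 1 \<or> j = i + 1 \<Longrightarrow> E (d - j) x \<noteq> 0 \<Longrightarrow> E (d - i) (As (E (d - j) x)) \<noteq> 0"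
      by (rule irred) (use ij in arith)+
  qed (fact tridiag_star irred_star)+
qed

lemma (in leonard_action) starred_reversed:
  "leonard_action sc d As (\<lambda>i. Es (d - i)) (\<lambda>i. \<theta>s (d - i)) A (\<lambda>i. E (d - i)) (\<lambda>i. \<theta> (d - i))"
  by (rule leonard_action.reversed[OF leonard_action.starred[OF reversed]])

lemma (in leonard_action) both_reversed:
  "leonard_action sc d A (\<lambda>i. E (d - i)) (\<lambda>i. \<theta> (d - i)) As (\<lambda>i. Es (d - i)) (\<lambda>i. \<theta>s (d - i))"
  by (rule leonard_action.starred[OF starred_reversed])

section \<open>The split decomposition\<close>

context leonard_action
begin

text \<open>
  Membership in \<open>U\<^sub>i\<close>, expressed by vanishing projections: a vector lies in \<open>E*\<^sub>0V + \<dots> + E*\<^sub>iV\<close> if and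
  only if its other starred projections vanish, and likewise for \<open>E\<^sub>iV + \<dots> + E\<^sub>dV\<close>.
\<close>

definition in_split :: "nat \<Rightarrow> 'v \<Rightarrow> bool" where
  "in_split i x \<longleftrightarrow> (\<forall>j\<le>d. i < j \<longrightarrow> Es j x = 0) \<and> (\<forall>j\<le>d. j < i \<longrightarrow> E j x = 0)"

text \<open>
  The scalar is required on all of \<open>U\<^sub>i\<close> and not just on one eigenvector. The equation is the one
  for \<open>(A - \<theta>\<^sub>i\<^sub>-\<^sub>1)(A* - \<theta>*\<^sub>i)\<close>.
\<close>

definition split_scalars :: "(nat \<Rightarrow> 'k) \<Rightarrow> bool" where
  "split_scalars \<phi> \<longleftrightarrow> (\<forall>i\<in>{1..d}. \<forall>x. in_split i x \<longrightarrow>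
     A (As x - \<theta>s i \<cdot> x) - \<theta> (i - 1) \<cdot> (As x - \<theta>s i \<cdot> x) = \<phi> i \<cdot> x)"

text \<open>
  In the expansion of \<open>E*\<^sub>k A x\<close> over \<open>x = \<Sum>\<^sub>j E*\<^sub>j x\<close> only \<open>j \<in> {k - 1, k, k + 1}\<close> can contribute. The lemma
  is for vectors with at most one of these three components nonzero.
\<close>

lemma tridiag_expand:
  assumes "k \<le> d" "\<And>j. j \<le> d \<Longrightarrow> j \<noteq> l \<Longrightarrow> Es j x = 0 \<or> k + 1 < j \<or> j + 1 < k" "l \<le> d"
  shows "Es k (A x) = Es k (A (Es l x))"
proof -
  have "Es k (A x) = (\<Sum>j\<le>d. Es k (A (Es j x)))"
    by (rule s.linear_expand) (use assms a.op.linear_axioms in auto)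
  also have "\<dots> = (\<Sum>j\<le>d. if j = l then Es k (A (Es l x)) else 0)"
  proof (rule sum.cong)
    fix j assume j: "j \<in> {..d}"
    show "Es k (A (Es j x)) = (if j = l then Es k (A (Es l x)) else 0)"
      using assms(2)[of j] j tridiag_star[of k j x] assms(1)
      by (auto simp: a.op.zero s.proj_simps)
  qed auto
  also have "\<dots> = Es k (A (Es l x))" using assms by simp
  finally show ?thesis .
qed

text \<open>
  Applying \<open>A\<close> moves the highest nonzero starred component up by exactly one index, and a scalar
  multiple of \<open>x\<close> does not reach that index.
\<close>

lemma shift_raises:
  assumes "r < d" "\<And>j. j \<le> d \<Longrightarrow> r < j \<Longrightarrow> Es j x = 0" "Es r x \<noteq> 0"
  shows "Es (Suc r) (A x - c \<cdot> x) \<noteq> 0"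
    and "j \<le> d \<Longrightarrow> Suc r < j \<Longrightarrow> Es j (A x - c \<cdot> x) = 0"
proof -
  have "Es (Suc r) (A x) = Es (Suc r) (A (Es r x))"
  proof (rule tridiag_expand)
    show "Es j x = 0 \<or> Suc r + 1 < j \<or> j + 1 < Suc r" if "j \<le> d" "j \<noteq> r" for j
      using assms(2)[of j] that by (cases "r < j") auto
  qed (use assms in auto)
  then show "Es (Suc r) (A x - c \<cdot> x) \<noteq> 0"
    using assms irred_star[of "Suc r" r x] by (simp add: s.proj_simps)
next
  assume j: "j \<le> d" "Suc r < j"
  have "Es j (A x) = Es j (A (Es j x))"
  proof (rule tridiag_expand)
    show "Es k x = 0 \<or> j + 1 < k \<or> k + 1 < j" if "k \<le> d" "k \<noteq> j" for k
      using assms(2)[of k] that j by (cases "r < k") auto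
  qed (use j in auto)
  then show "Es j (A x - c \<cdot> x) = 0"
    using assms j by (simp add: s.proj_simps a.op.zero)
qed

text \<open>
  If \<open>r < i\<close> is the highest index with \<open>E*\<^sub>r x \<noteq> 0\<close>, then each factor of
  \<open>(A - \<theta>\<^sub>i) \<dots> (A - \<theta>\<^sub>d)\<close> raises this index by one. There is room for all \<open>d - i + 1\<close> factors, so the
  result is nonzero. But this product kills \<open>E\<^sub>iV + \<dots> + E\<^sub>dV\<close>.
\<close>

lemma opposite_flags:
  assumes "i \<le> d" "\<And>j. j \<le> d \<Longrightarrow> i \<le> j \<Longrightarrow> Es j x = 0" "\<And>j. j \<le> d \<Longrightarrow> j < i \<Longrightarrow> E j x = 0"
  shows "x = 0"
proof (rule ccontr)
  assume "x \<noteq> 0"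
  define R where "R = {j. j \<le> d \<and> Es j x \<noteq> 0}"
  have fin: "finite R" unfolding R_def by simp
  have "R \<noteq> {}" using \<open>x \<noteq> 0\<close> s.eq_zero_if_projs_zero unfolding R_def by blast
  define r where "r = Max R"
  have r: "r \<in> R" unfolding r_def by (rule Max_in) fact+
  have above: "Es j x = 0" if "j \<le> d" "r < j" for j
    using that Max_ge[OF fin, of j] unfolding r_def R_def by (auto simp: not_le[symmetric])
  have ri: "r < i" using r assms(2) unfolding R_def by (auto simp: not_le[symmetric])
  let ?y = "\<lambda>n. shifted_product sc A (\<lambda>j. \<theta> (d - j)) n x"
  have lead: "r + n \<le> d \<Longrightarrow> Es (r + n) (?y n) \<noteq> 0 \<and> (\<forall>j\<le>d. r + n < j \<longrightarrow> Es j (?y n) = 0)" for n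
  proof (induction n)
    case 0
    then show ?case using r above unfolding R_def by simp
  next
    case (Suc n)
    then show ?case
      using shift_raises[of "r + n" "?y n"] by simp
  qed
  let ?n = "d - i + 1"
  have "?y ?n = 0"
  proof (rule a.eq_zero_if_projs_zero)
    fix j assume j: "j \<le> d"
    show "E j (?y ?n) = 0"
    proof (cases "j < i")
      case True
      then show ?thesis using assms(3) j a.proj_shifted_product[OF j] by (simp del: shifted_product.simps)
    next
      case False
      \<comment> \<open>The factor with \<open>k = d - j\<close> vanishes.\<close>
      then have "(\<Prod>k<?n. \<theta> j - \<theta> (d - k)) = 0"
        using j by (intro prod_zero bexI[of _ "d - j"]) auto
      then show ?thesis using a.proj_shifted_product[OF j]
        by (simp del: shifted_product.simps prod.lessThan_Suc)
    qed
  qed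
  moreover have "r + ?n \<le> d" using ri assms(1) by simp
  ultimately show False using lead[of ?n] by (simp add: s.proj_simps)
qed

text \<open>
  By \<open>opposite_flags\<close>, the projection onto \<open>E*\<^sub>iV\<close> is injective on \<open>U\<^sub>i\<close>. As \<open>E*\<^sub>iV\<close> is a line, \<open>U\<^sub>i\<close> is at
  most a line.
\<close>

lemma in_split_zero_iff:
  assumes "i \<le> d" "in_split i x" shows "Es i x = 0 \<longleftrightarrow> x = 0"
proof
  assume "Es i x = 0"
  show "x = 0"
    by (rule opposite_flags[of i])
      (use assms \<open>Es i x = 0\<close> in \<open>auto simp: in_split_def le_less\<close>)
qed (use assms in \<open>simp add: s.proj_simps\<close>)

lemma in_split_one_dim:
  assumes "i \<le> d" "in_split i x" "in_split i y" "x \<noteq> 0"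
  obtains c where "y = c \<cdot> x"
proof -
  have "Es i x \<noteq> 0" using in_split_zero_iff assms by blast
  then obtain c where c: "Es i y = c \<cdot> Es i x" using s.proj_rank_one assms by blast
  have "in_split i (y - c \<cdot> x)"
    using assms unfolding in_split_def by (auto simp: s.proj_simps a.proj_simps)
  moreover have "Es i (y - c \<cdot> x) = 0" using c assms by (simp add: s.proj_simps)
  ultimately have "y - c \<cdot> x = 0" using in_split_zero_iff assms by blast
  then show ?thesis by (intro that[of c]) simp
qed

lemma in_split_raise:
  assumes "i < d" "in_split i x"
  shows "in_split (Suc i) (A x - \<theta> i \<cdot> x)"
  unfolding in_split_def
proof safe
  fix j assume j: "j \<le> d" "Suc i < j"
  have "Es j (A x) = Es j (A (Es j x))"
  proof (rule tridiag_expand)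
    show "Es k x = 0 \<or> j + 1 < k \<or> k + 1 < j" if "k \<le> d" "k \<noteq> j" for k
      using assms(2) that j unfolding in_split_def by (cases "i < k") auto
  qed (use j in auto)
  then show "Es j (A x - \<theta> i \<cdot> x) = 0"
    using assms j by (simp add: s.proj_simps a.op.zero in_split_def)
next
  fix j assume j: "j \<le> d" "j < Suc i"
  then show "E j (A x - \<theta> i \<cdot> x) = 0"
    using assms by (cases "j = i") (auto simp: a.proj_simps a.proj_op in_split_def)
qed

text \<open>
  Reversing both orders and exchanging \<open>A\<close> with \<open>A*\<close> swaps the two sums whose intersection is
  \<open>U\<^sub>i\<close>. Statements about raising therefore give statements about lowering.
\<close>

lemma in_split_dual:
  assumes "i \<le> d"
  shows "in_split i x \<longleftrightarrow> leonard_action.in_split d (\<lambda>i. Es (d - i)) (\<lambda>i. E (d - i)) (d - i) x"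
proof -
  interpret r: leonard_action sc d As "\<lambda>i. Es (d - i)" "\<lambda>i. \<theta>s (d - i)" A "\<lambda>i. E (d - i)" "\<lambda>i. \<theta> (d - i)"
    by (rule starred_reversed)
  have rev: "(\<forall>j\<le>d. Q j) \<longleftrightarrow> (\<forall>j\<le>d. Q (d - j))" for Q :: "nat \<Rightarrow> bool"
    by (metis diff_diff_cancel diff_le_self)
  have less: "d - j < i \<longleftrightarrow> d - i < j" "i < d - j \<longleftrightarrow> j < d - i" if "j \<le> d" for j
    using assms that by arith+
  show ?thesis
    unfolding in_split_def r.in_split_def
      rev[of "\<lambda>j. i < j \<longrightarrow> Es j x = 0"] rev[of "\<lambda>j. j < i \<longrightarrow> E j x = 0"]
    using less by auto
qed

lemma in_split_lower:
  assumes "Suc i \<le> d" "in_split (Suc i) x"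
  shows "in_split i (As x - \<theta>s (Suc i) \<cdot> x)"
proof -
  interpret r: leonard_action sc d As "\<lambda>i. Es (d - i)" "\<lambda>i. \<theta>s (d - i)" A "\<lambda>i. E (d - i)" "\<lambda>i. \<theta> (d - i)"
    by (rule starred_reversed)
  have "r.in_split (Suc (d - Suc i)) (As x - \<theta>s (d - (d - Suc i)) \<cdot> x)"
    by (rule r.in_split_raise) (use assms in \<open>auto simp: in_split_dual\<close>)
  then show ?thesis using assms by (simp add: in_split_dual Suc_diff_Suc)
qed

lemma in_split_linear:
  "i \<le> d \<Longrightarrow> in_split i x \<Longrightarrow> in_split i (c \<cdot> x)"
  "i \<le> d \<Longrightarrow> in_split i x \<Longrightarrow> in_split i y \<Longrightarrow> in_split i (x - y)"
  unfolding in_split_def by (auto simp: s.proj_simps a.proj_simps)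

lemma raise_nonzero:
  assumes "i < d" "in_split i x" "x \<noteq> 0"
  shows "A x - \<theta> i \<cdot> x \<noteq> 0"
proof -
  have "Es i x \<noteq> 0" using assms in_split_zero_iff by simp
  then have "Es (Suc i) (A x - \<theta> i \<cdot> x) \<noteq> 0"
    using assms by (intro shift_raises) (auto simp: in_split_def)
  then show ?thesis using assms by (auto simp: s.proj_simps)
qed

lemma in_split_nonzero:
  "i \<le> d \<Longrightarrow> \<exists>x. in_split i x \<and> x \<noteq> 0"
proof (induction i)
  case 0
  obtain x where "Es 0 x \<noteq> 0" using s.proj_nonzero by blast
  then show ?case by (intro exI[of _ "Es 0 x"]) (simp add: in_split_def s.proj_proj)
next
  case (Suc i)
  then obtain x where "in_split i x" "x \<noteq> 0" by auto
  then show ?case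
    using in_split_raise[of i x] raise_nonzero[of i x] Suc.prems by (metis Suc_le_eq)
qed

section \<open>The scalars attached to the split decomposition\<close>

lemma split_scalars_from_eigenvectors:
  assumes "\<And>i. i \<in> {1..d} \<Longrightarrow> \<exists>x. in_split i x \<and> x \<noteq> 0 \<and>
     A (As x - \<theta>s i \<cdot> x) - \<theta> (i - 1) \<cdot> (As x - \<theta>s i \<cdot> x) = \<phi> i \<cdot> x"
  shows "split_scalars \<phi>"
  unfolding split_scalars_def
proof safe
  fix i y assume i: "i \<in> {1..d}" and y: "in_split i y"
  obtain x where x: "in_split i x" "x \<noteq> 0"
    "A (As x - \<theta>s i \<cdot> x) - \<theta> (i - 1) \<cdot> (As x - \<theta>s i \<cdot> x) = \<phi> i \<cdot> x"
    using assms[OF i] by blast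
  obtain c where c: "y = c \<cdot> x" using in_split_one_dim[of i x y] x y i by auto
  have "A (As y - \<theta>s i \<cdot> y) - \<theta> (i - 1) \<cdot> (As y - \<theta>s i \<cdot> y) =
    c \<cdot> (A (As x - \<theta>s i \<cdot> x) - \<theta> (i - 1) \<cdot> (As x - \<theta>s i \<cdot> x))"
    unfolding c
    by (simp add: a.op.scale s.op.scale a.op.diff a.op.vs1.scale_right_diff_distrib mult.commute)
  also have "\<dots> = \<phi> i \<cdot> y" unfolding x(3) c by (simp add: mult.commute)
  finally show "A (As y - \<theta>s i \<cdot> y) - \<theta> (i - 1) \<cdot> (As y - \<theta>s i \<cdot> y) = \<phi> i \<cdot> y" .
qed

lemma split_scalars_exist: "\<exists>\<phi>. split_scalars \<phi>"
proof -
  have "\<exists>c x. in_split i x \<and> x \<noteq> 0 \<and>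
     A (As x - \<theta>s i \<cdot> x) - \<theta> (i - 1) \<cdot> (As x - \<theta>s i \<cdot> x) = c \<cdot> x" if i: "i \<in> {1..d}" for i
  proof -
    obtain k where k: "i = Suc k" "k < d" using i by (cases i) auto
    obtain x where x: "in_split i x" "x \<noteq> 0" using in_split_nonzero i by auto
    have "in_split k (As x - \<theta>s i \<cdot> x)" using in_split_lower x k by simp
    then have "in_split i (A (As x - \<theta>s i \<cdot> x) - \<theta> (i - 1) \<cdot> (As x - \<theta>s i \<cdot> x))"
      using in_split_raise k by simp
    then show ?thesis using in_split_one_dim[of i x] x i by (metis atLeastAtMost_iff)
  qed
  then show ?thesis using split_scalars_from_eigenvectors by metis
qed

text \<open>
  Let \<open>w\<close> be the left-hand side. Raising \<open>w\<close> and raising \<open>\<phi>\<^sub>i\<^sub>+\<^sub>1 x\<close> both give \<open>\<phi>\<^sub>i\<^sub>+\<^sub>1 y\<close>, and raising is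
  injective on \<open>U\<^sub>i\<close> for \<open>i < d\<close>.
\<close>

lemma split_scalars_commute:
  assumes "split_scalars \<phi>" "i < d" "in_split i x"
  defines "y \<equiv> A x - \<theta> i \<cdot> x"
  shows "As y - \<theta>s (Suc i) \<cdot> y = \<phi> (Suc i) \<cdot> x"
proof -
  let ?w = "As y - \<theta>s (Suc i) \<cdot> y" and ?c = "\<phi> (Suc i)"
  have y: "in_split (Suc i) y" unfolding y_def using in_split_raise assms by simp
  then have w: "in_split i ?w" using in_split_lower assms by simp
  have Aw: "A ?w - \<theta> i \<cdot> ?w = ?c \<cdot> y"
    using assms(1)[unfolded split_scalars_def, rule_format, of "Suc i" y] y assms(2) by simp
  have "A (?w - ?c \<cdot> x) - \<theta> i \<cdot> (?w - ?c \<cdot> x) = (A ?w - \<theta> i \<cdot> ?w) - ?c \<cdot> (A x - \<theta> i \<cdot> x)"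
    by (simp add: a.op.diff a.op.scale a.op.vs1.scale_right_diff_distrib mult.commute)
  also have "\<dots> = 0" unfolding Aw by (simp add: y_def)
  finally have "?w - ?c \<cdot> x = 0"
    using raise_nonzero[of i "?w - ?c \<cdot> x"] w assms in_split_linear by auto
  then show ?thesis by simp
qed

lemma split_scalars_dual:
  assumes "split_scalars \<phi>"
  shows "leonard_action.split_scalars sc d As (\<lambda>i. Es (d - i)) (\<lambda>i. \<theta>s (d - i))
    A (\<lambda>i. E (d - i)) (\<lambda>i. \<theta> (d - i)) (\<lambda>i. \<phi> (d - i + 1))"
proof -
  interpret r: leonard_action sc d As "\<lambda>i. Es (d - i)" "\<lambda>i. \<theta>s (d - i)" A "\<lambda>i. E (d - i)" "\<lambda>i. \<theta> (d - i)"
    by (rule starred_reversed)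
  show ?thesis
    unfolding r.split_scalars_def
  proof safe
    fix i x assume i: "i \<in> {1..d}" and x: "r.in_split i x"
    have "in_split (d - i) x" using in_split_dual[of "d - i"] x i by simp
    then show "As (A x - \<theta> (d - i) \<cdot> x) - \<theta>s (d - (i - 1)) \<cdot> (A x - \<theta> (d - i) \<cdot> x)
        = \<phi> (d - i + 1) \<cdot> x"
      using split_scalars_commute[OF assms, of "d - i" x] i by (simp add: Suc_diff_le)
  qed
qed

text \<open>
  The basic identity. The vector \<open>H\<^sub>n = \<eta>*\<^sub>n(A*) E\<^sub>d x\<close> lies in \<open>U\<^sub>d\<^sub>-\<^sub>n\<close>, and \<open>H\<^sub>d\<close> is a multiple of \<open>E*\<^sub>0 E\<^sub>d x\<close>.
  Each further factor \<open>A - \<theta>\<^sub>i\<close>, applied to \<open>H\<^sub>d\<^sub>-\<^sub>i = (A* - \<theta>*\<^sub>i\<^sub>+\<^sub>1) H\<^sub>d\<^sub>-\<^sub>i\<^sub>-\<^sub>1\<close>, undoes one lowering step at the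
  price of the scalar \<open>\<phi>\<^sub>i\<^sub>+\<^sub>1\<close>.
\<close>

lemma shifted_product_split:
  assumes "split_scalars \<phi>" "i \<le> d"
  shows "(\<Prod>j<d. \<theta>s 0 - \<theta>s (d - j)) \<cdot> shifted_product sc A \<theta> i (Es 0 (E d x)) =
    (\<Prod>j\<in>{1..i}. \<phi> j) \<cdot> shifted_product sc As (\<lambda>j. \<theta>s (d - j)) (d - i) (E d x)"
proof -
  let ?H = "\<lambda>n. shifted_product sc As (\<lambda>j. \<theta>s (d - j)) n (E d x)"
  let ?c = "\<Prod>j<d. \<theta>s 0 - \<theta>s (d - j)"
  have H_split: "n \<le> d \<Longrightarrow> in_split (d - n) (?H n)" for n
  proof (induction n)
    case 0
    show ?case by (simp add: in_split_def a.proj_proj)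
  next
    case (Suc n)
    then show ?case using in_split_lower[of "d - Suc n" "?H n"] by (simp add: Suc_diff_Suc)
  qed
  have "?H d - ?c \<cdot> Es 0 (E d x) = 0"
  proof (rule s.eq_zero_if_projs_zero)
    fix k assume k: "k \<le> d"
    \<comment> \<open>The roots of \<open>\<eta>*\<^sub>d\<close> are all \<open>\<theta>*\<^sub>k\<close> except \<open>\<theta>*\<^sub>0\<close>; \<open>\<theta>*\<^sub>k\<close> occurs at \<open>j = d - k\<close>.\<close>
    have "(\<Prod>j<d. \<theta>s k - \<theta>s (d - j)) = 0" if "k \<noteq> 0"
      by (rule prod_zero) (use k that in \<open>auto intro!: bexI[of _ "d - k"]\<close>)
    then show "Es k (?H d - ?c \<cdot> Es 0 (E d x)) = 0"
      using k s.proj_shifted_product[OF k] by (auto simp: s.proj_simps s.proj_proj)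
  qed
  then have H_d: "?H d = ?c \<cdot> Es 0 (E d x)" by simp
  have "i \<le> d \<Longrightarrow> shifted_product sc A \<theta> i (?H d) = (\<Prod>j\<in>{1..i}. \<phi> j) \<cdot> ?H (d - i)"
  proof (induction i)
    case (Suc i)
    let ?u = "?H (d - Suc i)" and ?p = "\<Prod>j\<in>{1..i}. \<phi> j"
    have "?H (d - i) = ?H (Suc (d - Suc i))" using Suc by (simp add: Suc_diff_Suc del: shifted_product.simps)
    then have u: "?H (d - i) = As ?u - \<theta>s (Suc i) \<cdot> ?u" using Suc by simp
    have "in_split (Suc i) ?u" using H_split[of "d - Suc i"] Suc by simp
    then have "A (?H (d - i)) - \<theta> i \<cdot> ?H (d - i) = \<phi> (Suc i) \<cdot> ?u"
      using assms(1)[unfolded split_scalars_def, rule_format, of "Suc i" ?u] Suc unfolding u by simp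
    moreover have "shifted_product sc A \<theta> (Suc i) (?H d) = ?p \<cdot> (A (?H (d - i)) - \<theta> i \<cdot> ?H (d - i))"
      using Suc by (simp add: a.op.scale a.op.vs1.scale_right_diff_distrib mult.commute)
    ultimately have "shifted_product sc A \<theta> (Suc i) (?H d) = ?p \<cdot> (\<phi> (Suc i) \<cdot> ?u)" by simp
    then show ?case by (simp add: atLeastAtMostSuc_conv mult.commute)
  qed simp
  with assms(2) show ?thesis unfolding H_d a.shifted_product_scale by simp
qed

text \<open>
  Take a nonzero \<open>u \<in> U\<^sub>j\<close>. The component \<open>E*\<^sub>j A u\<close> is known because \<open>A u - \<theta>\<^sub>j u\<close> lies in \<open>U\<^sub>j\<^sub>+\<^sub>1\<close> and is
  lowered back to a multiple of \<open>u\<close>; this gives the term with \<open>\<phi>\<^sub>j\<^sub>+\<^sub>1\<close>. It differs from \<open>E*\<^sub>j A E*\<^sub>j u\<close> by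
  \<open>E*\<^sub>j A E*\<^sub>j\<^sub>-\<^sub>1 u\<close>, which is known because \<open>A* u - \<theta>*\<^sub>j u\<close> lies in \<open>U\<^sub>j\<^sub>-\<^sub>1\<close> and is raised back to \<open>\<phi>\<^sub>j u\<close>;
  this gives the term with \<open>\<phi>\<^sub>j\<close>.
\<close>

lemma proj_op_proj:
  assumes "split_scalars \<phi>" "j \<le> d"
  shows "Es j (A (Es j x)) = (\<theta> j
    + (if j < d then \<phi> (j + 1) / (\<theta>s j - \<theta>s (j + 1)) else 0)
    + (if 0 < j then \<phi> j / (\<theta>s j - \<theta>s (j - 1)) else 0)) \<cdot> Es j x"
proof -
  obtain u where u: "in_split j u" "u \<noteq> 0" using in_split_nonzero assms(2) by blast
  have eu: "Es j u \<noteq> 0" using in_split_zero_iff u assms(2) by blast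
  have \<theta>s_neq: "\<theta>s j \<noteq> \<theta>s k" if "k \<noteq> j" "k \<le> d" for k
    using s.\<theta>_inj that assms(2) by (auto simp: inj_on_def)
  define a where "a = (if j < d then \<phi> (j + 1) / (\<theta>s j - \<theta>s (j + 1)) else 0)"
  define b where "b = (if 0 < j then \<phi> j / (\<theta>s j - \<theta>s (j - 1)) else 0)"
  have up: "Es j (A u) = (\<theta> j + a) \<cdot> Es j u"
  proof (cases "j < d")
    case True
    define q where "q = A u - \<theta> j \<cdot> u"
    have "As q - \<theta>s (Suc j) \<cdot> q = \<phi> (Suc j) \<cdot> u"
      unfolding q_def by (rule split_scalars_commute) fact+
    then have "Es j (As q - \<theta>s (Suc j) \<cdot> q) = Es j (\<phi> (Suc j) \<cdot> u)" by simp
    then have "(\<theta>s j - \<theta>s (Suc j)) \<cdot> Es j q = \<phi> (Suc j) \<cdot> Es j u"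
      using assms(2) by (simp add: s.proj_simps s.proj_op a.op.vs1.scale_left_diff_distrib)
    then have "(1 / (\<theta>s j - \<theta>s (Suc j))) \<cdot> ((\<theta>s j - \<theta>s (Suc j)) \<cdot> Es j q) = a \<cdot> Es j u"
      using True by (simp add: a_def)
    then have "Es j q = a \<cdot> Es j u" using \<theta>s_neq[of "Suc j"] True by simp
    then show ?thesis unfolding q_def
      using assms(2) by (simp add: s.proj_simps a.op.vs1.scale_left_distrib algebra_simps)
  next
    case False
    then have "E k (A u - \<theta> j \<cdot> u) = 0" if "k \<le> d" for k
      using u(1) that assms(2) by (cases "k = j") (auto simp: in_split_def a.proj_simps a.proj_op)
    then have "A u - \<theta> j \<cdot> u = 0" by (rule a.eq_zero_if_projs_zero)
    then show ?thesis using False assms(2) by (simp add: a_def s.proj_simps)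
  qed
  have "Es j (A (Es j u)) = (\<theta> j + a + b) \<cdot> Es j u"
  proof (cases "0 < j")
    case False
    have "Es j (A u) = Es j (A (Es j u))"
      by (rule tridiag_expand) (use u False assms(2) in \<open>auto simp: in_split_def\<close>)
    then show ?thesis using up False by (simp add: b_def)
  next
    case True
    then obtain k where k: "j = Suc k" by (cases j) auto
    define w where "w = As u - \<theta>s j \<cdot> u"
    have w: "in_split k w" unfolding w_def k by (rule in_split_lower) (use u k assms(2) in auto)
    have Aw: "A w - \<theta> k \<cdot> w = \<phi> j \<cdot> u"
      using assms(1)[unfolded split_scalars_def, rule_format, of j u] u k assms(2)
      unfolding w_def by simp
    have "Es j w = 0" using w k assms(2) by (simp add: in_split_def)
    have "Es j (A w) = Es j (A (Es k w))"
    proof (rule tridiag_expand)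
      show "Es l w = 0 \<or> j + 1 < l \<or> l + 1 < j" if "l \<le> d" "l \<noteq> k" for l
        using w that k by (cases "k < l") (auto simp: in_split_def)
    qed (use k assms(2) in auto)
    moreover have "Es k w = (\<theta>s k - \<theta>s j) \<cdot> Es k u"
      unfolding w_def using k assms(2)
      by (simp add: s.proj_simps s.proj_op a.op.vs1.scale_left_diff_distrib)
    moreover have "Es j (A w) = \<phi> j \<cdot> Es j u"
    proof -
      have "Es j (A w - \<theta> k \<cdot> w) = Es j (\<phi> j \<cdot> u)" unfolding Aw ..
      then show ?thesis using \<open>Es j w = 0\<close> assms(2) by (simp add: s.proj_simps)
    qed
    ultimately have "(\<theta>s k - \<theta>s j) \<cdot> Es j (A (Es k u)) = \<phi> j \<cdot> Es j u"
      using assms(2) by (simp add: a.op.scale s.proj_simps)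
    then have "(1 / (\<theta>s k - \<theta>s j)) \<cdot> ((\<theta>s k - \<theta>s j) \<cdot> Es j (A (Es k u))) =
        (\<phi> j / (\<theta>s k - \<theta>s j)) \<cdot> Es j u"
      by simp
    moreover have "\<phi> j / (\<theta>s k - \<theta>s j) = - b"
      using True k by (simp add: b_def) (metis minus_diff_eq minus_divide_right)
    ultimately have sub: "Es j (A (Es k u)) = - b \<cdot> Es j u"
      using \<theta>s_neq[of k] k assms(2) by simp
    \<comment> \<open>Apart from \<open>E*\<^sub>j u\<close>, only the component of \<open>u\<close> at \<open>k = j - 1\<close> is within reach of \<open>E*\<^sub>j A\<close>.\<close>
    have "Es j (A (Es k u) + A (Es j u)) = Es j (A u)"
    proof -
      have "Es j (A (u - Es j u)) = Es j (A (Es k (u - Es j u)))"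
      proof (rule tridiag_expand)
        show "Es l (u - Es j u) = 0 \<or> j + 1 < l \<or> l + 1 < j" if "l \<le> d" "l \<noteq> k" for l
          using u(1) that k assms(2)
          by (cases "l = j"; cases "j < l") (auto simp: in_split_def s.proj_simps s.proj_proj)
      qed (use k assms(2) in auto)
      also have "Es k (u - Es j u) = Es k u" using k assms(2) by (simp add: s.proj_simps s.proj_proj)
      finally show ?thesis using assms(2) by (simp add: a.op.diff s.proj_simps diff_eq_eq)
    qed
    then have "Es j (A (Es j u)) = Es j (A u) - Es j (A (Es k u))"
      using assms(2) by (simp add: s.proj_simps algebra_simps)
    then show ?thesis unfolding up sub by (simp add: a.op.vs1.scale_left_distrib)
  qed
  moreover obtain c where c: "Es j x = c \<cdot> Es j u" using s.proj_rank_one[OF assms(2) eu] by blast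
  ultimately show ?thesis
    using assms(2) unfolding a_def[symmetric] b_def[symmetric] c
    by (simp add: a.op.scale s.proj_simps mult.commute)
qed

text \<open>
  Let \<open>\<psi>\<close> be the scalars of the reversed system. The two systems have the same \<open>E*\<^sub>j A E*\<^sub>j\<close>, up to the
  numbering, so \<open>proj_op_proj\<close> gives two expressions for its scalar: one in \<open>\<phi>\<^sub>j\<close> and \<open>\<phi>\<^sub>j\<^sub>+\<^sub>1\<close>, the
  other, with the same coefficients, in \<open>\<psi>\<^sub>d\<^sub>-\<^sub>j\<^sub>+\<^sub>1\<close> and \<open>\<psi>\<^sub>d\<^sub>-\<^sub>j\<close>. Induction on \<open>j\<close> shows that
  \<open>\<psi>\<^sub>d\<^sub>-\<^sub>j = \<phi>\<^sub>j\<^sub>+\<^sub>1\<close>; for \<open>j = 0\<close> the first terms are absent.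
\<close>

lemma split_scalars_both_reversed:
  assumes "split_scalars \<phi>"
  shows "leonard_action.split_scalars sc d A (\<lambda>i. E (d - i)) (\<lambda>i. \<theta> (d - i))
    As (\<lambda>i. Es (d - i)) (\<lambda>i. \<theta>s (d - i)) (\<lambda>i. \<phi> (d - i + 1))"
proof -
  interpret r: leonard_action sc d A "\<lambda>i. E (d - i)" "\<lambda>i. \<theta> (d - i)"
    As "\<lambda>i. Es (d - i)" "\<lambda>i. \<theta>s (d - i)"
    by (rule both_reversed)
  obtain \<psi> where \<psi>: "r.split_scalars \<psi>" using r.split_scalars_exist by blast
  have eq: "j < d \<Longrightarrow> \<psi> (d - j) = \<phi> (j + 1)" for j
  proof (induction j rule: less_induct)
    case (less j)
    obtain x where x: "Es j x \<noteq> 0" using s.proj_nonzero less.prems by (meson less_imp_le)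
    have "\<theta> j + \<phi> (j + 1) / (\<theta>s j - \<theta>s (j + 1)) + (if 0 < j then \<phi> j / (\<theta>s j - \<theta>s (j - 1)) else 0)
      = \<theta> j + (if 0 < j then \<psi> (d - j + 1) / (\<theta>s j - \<theta>s (j - 1)) else 0)
        + \<psi> (d - j) / (\<theta>s j - \<theta>s (j + 1))" (is "?l = ?r")
    proof -
      have "Es j (A (Es j x)) = ?l \<cdot> Es j x"
        using proj_op_proj[OF assms, of j x] less.prems by simp
      moreover have "Es j (A (Es j x)) = ?r \<cdot> Es j x"
        using r.proj_op_proj[OF \<psi>, of "d - j" x] less.prems
        by (simp add: Suc_diff_le[symmetric] Suc_diff_Suc split: if_splits)
      ultimately have "?l \<cdot> Es j x = ?r \<cdot> Es j x" by (rule trans[OF sym])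
      with x show ?thesis by (simp only: a.op.vs1.scale_cancel_right simp_thms)
    qed
    moreover have "\<psi> (d - j + 1) = \<phi> j" if "0 < j"
      using less.IH[of "j - 1"] that less.prems by (cases j) (simp_all add: Suc_diff_Suc)
    moreover have "\<theta>s j \<noteq> \<theta>s (j + 1)"
      using inj_onD[OF s.\<theta>_inj, of j "j + 1"] less.prems by auto
    ultimately show ?case by (cases "0 < j") auto
  qed
  show ?thesis
    unfolding r.split_scalars_def
  proof safe
    fix i x assume i: "i \<in> {1..d}" and x: "r.in_split i x"
    have "\<psi> i = \<phi> (d - i + 1)" using eq[of "d - i"] i by simp
    then show "A (As x - \<theta>s (d - i) \<cdot> x) - \<theta> (d - (i - 1)) \<cdot> (As x - \<theta>s (d - i) \<cdot> x)
        = \<phi> (d - i + 1) \<cdot> x"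
      using \<psi>[unfolded r.split_scalars_def, rule_format, of i x] i x by simp
  qed
qed

end

section \<open>The simple module of a matrix algebra\<close>

text \<open>
  The matrix units \<open>e\<^sub>p\<^sub>q\<close> and the matrix entries \<open>c x q r\<close>, carried over to the algebra. All that is
  used of the isomorphism with the matrix algebra is in these three properties.
\<close>

lemma (in matrix_algebra) matrix_units:
  "\<exists>(e :: nat \<Rightarrow> nat \<Rightarrow> 'a) (c :: 'a \<Rightarrow> nat \<Rightarrow> nat \<Rightarrow> 'k).
    (\<Sum>p\<le>d. e p p) = 1 \<and>
    (\<forall>p\<le>d. \<forall>q\<le>d. \<forall>r\<le>d. \<forall>s\<le>d. \<forall>x. e p q * x * e r s = scale (c x q r) (e p s)) \<and>
    (\<forall>x. (\<forall>q\<le>d. \<forall>r\<le>d. c x q r = 0) \<longrightarrow> x = 0)"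
proof -
  obtain f where f: "matrix_algebra_iso scale (Suc d) f" using iso_Mat by blast
  then have bij: "bij_betw f UNIV (carrier_mat (Suc d) (Suc d))"
    and one: "f 1 = 1\<^sub>m (Suc d)" and add: "\<And>x y. f (x + y) = f x + f y"
    and mult: "\<And>x y. f (x * y) = f x * f y" and scl: "\<And>c x. f (scale c x) = c \<cdot>\<^sub>m f x"
    unfolding matrix_algebra_iso_def by auto
  have carr: "f x \<in> carrier_mat (Suc d) (Suc d)" for x using bij by (auto simp: bij_betw_def)
  have dims: "dim_row (f x) = Suc d" "dim_col (f x) = Suc d" for x using carr[of x] by auto
  have inj: "f x = f y \<Longrightarrow> x = y" for x y using bij by (auto simp: bij_betw_def inj_def)
  have eqI: "x = y" if "\<And>a b. a \<le> d \<Longrightarrow> b \<le> d \<Longrightarrow> f x $$ (a, b) = f y $$ (a, b)" for x y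
    by (rule inj, rule eq_matI) (use that dims in auto)
  have zero: "f 0 $$ (a, b) = 0" if "a \<le> d" "b \<le> d" for a b
  proof -
    have "f 0 $$ (a, b) = (f 0 + f 0) $$ (a, b)" by (simp flip: add)
    also have "\<dots> = f 0 $$ (a, b) + f 0 $$ (a, b)" using dims[of 0] that by simp
    finally show ?thesis by (metis add_cancel_right_right)
  qed
  have sum: "f (sum g J) $$ (a, b) = (\<Sum>j\<in>J. f (g j) $$ (a, b))"
    if "a \<le> d" "b \<le> d" "finite J" for a b and g :: "nat \<Rightarrow> 'a" and J
    using that(3) by induction (use that dims in \<open>auto simp: zero add\<close>)
  have prod: "f (x * y) $$ (a, b) = (\<Sum>k\<le>d. f x $$ (a, k) * f y $$ (k, b))"
    if "a \<le> d" "b \<le> d" for x y a b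
    using that dims by (simp add: mult scalar_prod_def atLeast0LessThan lessThan_Suc_atMost)
  define e where "e p q = inv_into UNIV f (mat (Suc d) (Suc d) (\<lambda>(a, b). if a = p \<and> b = q then 1 else 0))" for p q
  have fe: "f (e p q) $$ (a, b) = (if a = p then if b = q then 1 else 0 else 0)" if "a \<le> d" "b \<le> d" for p q a b
  proof -
    have "mat (Suc d) (Suc d) (\<lambda>(a, b). if a = p \<and> b = q then 1 else 0) \<in> range f"
      using bij by (auto simp: bij_betw_def)
    then have "f (e p q) = mat (Suc d) (Suc d) (\<lambda>(a, b). if a = p \<and> b = q then 1 else 0)"
      unfolding e_def by (rule f_inv_into_f)
    then show ?thesis using that by simp
  qed
  show ?thesis
  proof (intro exI[of _ e] exI[of _ "\<lambda>x q r. f x $$ (q, r)"] conjI allI impI)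
    show "(\<Sum>p\<le>d. e p p) = 1"
      by (rule eqI) (auto simp: sum fe one)
    show "e p q * x * e r s = scale (f x $$ (q, r)) (e p s)"
      if "p \<le> d" "q \<le> d" "r \<le> d" "s \<le> d" for p q r s x
      by (rule eqI) (use that dims in \<open>auto simp: prod fe scl if_distrib[of "\<lambda>z. z * _"]
        if_distrib[of "\<lambda>z. _ * z"] cong: if_cong\<close>)
    show "x = 0" if "\<forall>q\<le>d. \<forall>r\<le>d. f x $$ (q, r) = 0" for x
      by (rule eqI) (use that zero in auto)
  qed
qed

locale matrix_algebra_module = matrix_algebra scale d + simple_left_module act
  for scale :: "'k::field \<Rightarrow> 'a::ring_1 \<Rightarrow> 'a" and d :: nat
    and act :: "'a \<Rightarrow> 'v::ab_group_add \<Rightarrow> 'v"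
begin

definition smult :: "'k \<Rightarrow> 'v \<Rightarrow> 'v" where
  "smult c v = act (scale c 1) v"

lemma act_zero_right [simp]: "act x 0 = 0"
  using act_add_right[of x 0 0] by simp

lemma act_zero_left [simp]: "act 0 v = 0"
  using act_add_left[of 0 0 v] by simp

lemma act_diff_left: "act (x - y) v = act x v - act y v"
  using act_add_left[of "x - y" y v] by (simp add: algebra_simps)

lemma act_sum_left: "act (sum g J) v = (\<Sum>j\<in>J. act (g j) v)"
  by (induction J rule: infinite_finite_induct) (simp_all add: act_add_left)

lemma act_sum_right: "act x (sum g J) = (\<Sum>j\<in>J. act x (g j))"
  by (induction J rule: infinite_finite_induct) (simp_all add: act_add_right)

lemma act_scale: "act (scale c x) v = smult c (act x v)"
  using act_mult[of "scale c 1" x v] by (simp add: smult_def scale_mult_left)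

lemma act_smult: "act x (smult c v) = smult c (act x v)"
  using act_mult[of x "scale c 1" v] act_scale[of c x v] by (simp add: smult_def scale_mult_right)

sublocale V: vector_space smult
proof
  fix a b :: 'k and x y :: 'v
  show "smult a (x + y) = smult a x + smult a y" by (simp add: smult_def act_add_right)
  show "smult (a + b) x = smult a x + smult b x"
    by (simp add: smult_def scale_left_distrib act_add_left)
  show "smult a (smult b x) = smult (a * b) x"
    using act_mult[of "scale a 1" "scale b 1" x] by (simp add: smult_def scale_mult_left)
  show "smult 1 x = x" by (simp add: smult_def act_one)
qed

lemma act_linear: "Vector_Spaces.linear smult smult (act x)"
  by unfold_locales (simp_all add: act_add_right act_smult)

text \<open>
  If \<open>z = x - y \<noteq> 0\<close> has the nonzero entry \<open>z\<^sub>q\<^sub>r\<close>, then \<open>e\<^sub>p\<^sub>q z e\<^sub>r\<^sub>p = z\<^sub>q\<^sub>r e\<^sub>p\<^sub>p\<close>. If \<open>z\<close> acts as zero, so does every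
  \<open>e\<^sub>p\<^sub>p\<close>, hence so does \<open>1 = \<Sum>\<^sub>p e\<^sub>p\<^sub>p\<close>.
\<close>

lemma faithful:
  assumes "\<And>v. act x v = act y v" shows "x = y"
proof (rule ccontr)
  assume "x \<noteq> y"
  obtain e c where one: "(\<Sum>p\<le>d. e p p) = 1"
    and unit: "\<forall>p\<le>d. \<forall>q\<le>d. \<forall>r\<le>d. \<forall>s\<le>d. \<forall>x. e p q * x * e r s = scale (c x q r) (e p s)"
    and zero: "\<And>x. \<forall>q\<le>d. \<forall>r\<le>d. c x q r = 0 \<Longrightarrow> x = 0"
    using matrix_units by blast
  obtain q r where qr: "q \<le> d" "r \<le> d" "c (x - y) q r \<noteq> 0"
    using zero[of "x - y"] \<open>x \<noteq> y\<close> by auto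
  have "act (e p p) v = 0" if "p \<le> d" for p v
  proof -
    have "smult (c (x - y) q r) (act (e p p) v) = act (e p q * (x - y) * e r p) v"
      using that qr by (simp add: unit act_scale)
    also have "\<dots> = 0" using assms by (simp add: act_mult act_diff_left)
    finally show ?thesis using qr by simp
  qed
  then have "act 1 v = 0" for v by (simp add: one[symmetric] act_sum_left)
  then show False using nontrivial by (simp add: act_one)
qed

text \<open>
  Choose \<open>p\<close> and \<open>v\<close> with \<open>e\<^sub>p\<^sub>p v \<noteq> 0\<close>. By simplicity this vector generates the module, and
  \<open>x e\<^sub>p\<^sub>p = \<Sum>\<^sub>q x\<^sub>q\<^sub>p e\<^sub>q\<^sub>p\<close> shows that the \<open>e\<^sub>q\<^sub>p v\<close> span what it generates.
\<close>

lemma finite_spanning_set: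
  obtains S where "finite S" "card S \<le> Suc d" "V.span S = UNIV"
proof -
  obtain e c where one: "(\<Sum>p\<le>d. e p p) = 1"
    and unit: "\<forall>p\<le>d. \<forall>q\<le>d. \<forall>r\<le>d. \<forall>s\<le>d. \<forall>x. e p q * x * e r s = scale (c x q r) (e p s)"
    using matrix_units by blast
  obtain v :: 'v where "v \<noteq> 0" using nontrivial by blast
  then have "(\<Sum>p\<le>d. act (e p p) v) \<noteq> 0" using one by (metis act_sum_left act_one)
  then obtain p where p: "p \<le> d" "act (e p p) v \<noteq> 0" by (meson sum.neutral atMost_iff)
  define S where "S = (\<lambda>q. act (e q p) v) ` {..d}"
  define W where "W = range (\<lambda>x. act x (act (e p p) v))"
  have "W = {0} \<or> W = UNIV"
  proof (rule simple)
    show "0 \<in> W" unfolding W_def by (rule range_eqI[of _ _ 0]) simp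
    show "x + y \<in> W" if "x \<in> W" "y \<in> W" for x y
      using that unfolding W_def by (auto simp: act_add_left[symmetric])
    show "act x w \<in> W" if w: "w \<in> W" for x w
    proof -
      obtain y where "w = act y (act (e p p) v)" using w unfolding W_def by blast
      then show ?thesis unfolding W_def by (intro range_eqI[of _ _ "x * y"]) (simp add: act_mult)
    qed
  qed
  moreover have "act (e p p) v \<in> W" unfolding W_def by (rule range_eqI[of _ _ 1]) (simp add: act_one)
  ultimately have "W = UNIV" using p by auto
  moreover have "W \<subseteq> V.span S"
  proof
    fix w assume "w \<in> W"
    then obtain x where w: "w = act (x * e p p) v" unfolding W_def by (auto simp: act_mult)
    have "x * e p p = (\<Sum>q\<le>d. e q q) * x * e p p" by (simp add: one)
    also have "\<dots> = (\<Sum>q\<le>d. scale (c x q p) (e q p))"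
      using p by (simp add: sum_distrib_right unit)
    finally have "w = (\<Sum>q\<le>d. smult (c x q p) (act (e q p) v))"
      using w by (simp add: act_sum_left act_scale)
    then show "w \<in> V.span S"
      unfolding S_def by (simp only:) (intro V.span_sum V.span_scale V.span_base imageI)
  qed
  moreover have "card S \<le> Suc d" unfolding S_def using card_image_le[of "{..d}"] by (metis card_atMost finite_atMost)
  ultimately show ?thesis using that[of S] unfolding S_def by blast
qed

lemma act_primitive_idempotent_eigenvector:
  assumes "inj_on \<theta> {..d}" "i \<le> d" "k \<le> d" "act X b = smult (\<theta> k) b"
  shows "act (primitive_idempotent scale d X \<theta> i) b = (if i = k then b else 0)"
proof -
  have list: "act (prod_list (map (\<lambda>j. scale (1 / (\<theta> i - \<theta> j)) (X - scale (\<theta> j) 1)) js)) b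
    = smult (prod_list (map (\<lambda>j. (\<theta> k - \<theta> j) / (\<theta> i - \<theta> j)) js)) b" for js
    by (induction js)
      (simp_all add: act_one act_mult act_smult act_scale act_diff_left assms(4)
        V.scale_left_diff_distrib[symmetric] mult.commute)
  show ?thesis
  proof (cases "i = k")
    case True
    have "prod_list (map (\<lambda>j. (\<theta> k - \<theta> j) / (\<theta> i - \<theta> j)) js) = 1" if "\<forall>j\<in>set js. j \<le> d \<and> j \<noteq> i" for js
      using that
    proof (induction js)
      case (Cons j js)
      then have "\<theta> i \<noteq> \<theta> j" using assms(1,2) by (auto simp: inj_on_def)
      with Cons True show ?case by simp
    qed simp
    then show ?thesis unfolding primitive_idempotent_def list using True by simp
  next
    case False
    then have "prod_list (map (\<lambda>j. (\<theta> k - \<theta> j) / (\<theta> i - \<theta> j)) (filter (\<lambda>j. j \<noteq> i) [0..<Suc d])) = 0"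
      unfolding prod_list_zero_iff using assms(3) by (auto intro!: image_eqI[of _ _ k] simp del: upt_Suc)
    then show ?thesis unfolding primitive_idempotent_def list using False by simp
  qed
qed

text \<open>
  The \<open>d + 1\<close> eigenvectors of \<open>X\<close> are independent, as the \<open>P\<^sub>i\<close> separate them, and they span the module
  because \<open>d + 1\<close> vectors do. The required properties of the \<open>P\<^sub>i\<close> can thus be checked on
  eigenvectors, where each \<open>P\<^sub>i\<close> acts as \<open>0\<close> or as \<open>1\<close>.
\<close>

lemma eigen_resolution_of_idempotent_ordering:
  assumes "idempotent_ordering scale d act X P \<theta>"
  shows "eigen_resolution smult (act X) d (\<lambda>i. act (P i)) \<theta>"
proof -
  have inj: "inj_on \<theta> {..d}" and img: "\<theta> ` {..d} = eigenvalues scale act X"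
    using assms by (auto simp: idempotent_ordering_def bij_betw_def)
  have "\<forall>j\<in>{..d}. \<exists>b. b \<noteq> 0 \<and> act X b = smult (\<theta> j) b"
    using img by (auto simp: eigenvalues_def eigenvalue_on_def smult_def)
  then obtain b where b: "\<And>j. j \<le> d \<Longrightarrow> b j \<noteq> 0" "\<And>j. j \<le> d \<Longrightarrow> act X (b j) = smult (\<theta> j) (b j)"
    by (metis atMost_iff)
  have P_b: "act (P i) (b k) = (if i = k then b k else 0)" if "i \<le> d" "k \<le> d" for i k
    using act_primitive_idempotent_eigenvector[OF inj that b(2)] that assms
    by (simp add: idempotent_ordering_def)
  have b_inj: "inj_on b {..d}"
    by (rule inj_onI) (metis P_b atMost_iff b(1))
  have indep: "V.independent (b ` {..d})"
  proof (rule V.independent_if_scalars_zero)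
    fix f x assume sum: "(\<Sum>x\<in>b ` {..d}. smult (f x) x) = 0" and "x \<in> b ` {..d}"
    then obtain k where k: "k \<le> d" "x = b k" by auto
    have "act (P k) (\<Sum>j\<le>d. smult (f (b j)) (b j)) = 0"
      using sum by (simp add: sum.reindex[OF b_inj])
    moreover have "act (P k) (\<Sum>j\<le>d. smult (f (b j)) (b j)) = (\<Sum>j\<le>d. if j = k then smult (f x) x else 0)"
      unfolding act_sum_right act_smult
      by (rule sum.cong) (use k P_b in auto)
    ultimately show "f x = 0" using k b(1) by simp
  qed simp
  obtain S where S: "finite S" "card S \<le> Suc d" "V.span S = UNIV" using finite_spanning_set .
  have span: "V.span (b ` {..d}) = UNIV"
  proof (rule ccontr)
    assume "V.span (b ` {..d}) \<noteq> UNIV"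
    then obtain y where y: "y \<notin> V.span (b ` {..d})" by blast
    then have "y \<notin> b ` {..d}" using V.span_base[of y "b ` {..d}"] by blast
    then have "card (insert y (b ` {..d})) = Suc (Suc d)" using b_inj by (simp add: card_image)
    moreover have "card (insert y (b ` {..d})) \<le> card S"
      using V.independent_span_bound[OF S(1) V.independent_insertI[OF y indep]] S(3) by simp
    ultimately show False using S(2) by simp
  qed
  have ext: "act y x = act z x" if "\<And>k. k \<le> d \<Longrightarrow> act y (b k) = act z (b k)" for y z x
  proof -
    interpret vector_space_pair smult smult by unfold_locales
    show ?thesis
      by (rule linear_eq_on_span[of _ _ "b ` {..d}"]) (use that span in \<open>auto intro: act_linear\<close>)
  qed
  show ?thesis
  proof
    fix i j x
    show "act (P i) (act (P j) x) = (if i = j then act (P j) x else 0)" if "i \<le> d" "j \<le> d"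
    proof -
      have "act (P i * P j) x = act (if i = j then P j else 0) x"
        by (rule ext) (use that P_b in \<open>auto simp: act_mult\<close>)
      then show ?thesis by (simp add: act_mult split: if_splits)
    qed
    show "act X (act (P j) x) = smult (\<theta> j) (act (P j) x)" if "j \<le> d"
    proof -
      have "act (X * P j) x = act (scale (\<theta> j) (P j)) x"
        by (rule ext) (use that P_b b(2) in \<open>auto simp: act_mult act_scale\<close>)
      then show ?thesis by (simp add: act_mult act_scale)
    qed
    show "\<exists>x. act (P j) x \<noteq> 0" if "j \<le> d"
      using P_b[of j j] b(1) that by metis
    show "\<exists>c. act (P j) y = smult c (act (P j) x)" if "j \<le> d" "act (P j) x \<noteq> 0" for y
    proof -
      \<comment> \<open>The image of \<open>P\<^sub>j\<close> is the line through the \<open>j\<close>-th eigenvector.\<close>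
      have line: "\<exists>c. act (P j) z = smult c (b j)" for z
      proof -
        have "z \<in> V.span (b ` {..d})" using span by simp
        then show ?thesis
        proof (induction rule: V.span_induct_alt)
          case base
          show ?case by (rule exI[of _ 0]) simp
        next
          case (step c v w)
          then obtain k a where k: "k \<le> d" "v = b k" and a: "act (P j) w = smult a (b j)" by auto
          then show ?case
            using P_b[OF that(1) k(1)]
            by (intro exI[of _ "(if j = k then c else 0) + a"])
              (auto simp: act_add_right act_smult V.scale_left_distrib)
        qed
      qed
      obtain a a' where a: "act (P j) y = smult a (b j)" and a': "act (P j) x = smult a' (b j)"
        using line by blast
      then have "a' \<noteq> 0" using that by auto
      then have "act (P j) y = smult (a / a') (act (P j) x)" unfolding a a' by simp
      then show ?thesis ..
    qed
    show "(\<Sum>j\<le>d. act (P j) x) = x"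
    proof -
      have "act (\<Sum>j\<le>d. P j) x = act 1 x"
        by (rule ext) (use P_b in \<open>auto simp: act_sum_left act_one\<close>)
      then show ?thesis by (simp add: act_sum_left act_one)
    qed
  qed (use inj in \<open>simp_all add: act_add_right act_smult act_linear\<close>)
qed

end

section \<open>Polynomials in an algebra element\<close>

lemma tau_poly_cong: "(\<And>j. j < n \<Longrightarrow> r j = r' j) \<Longrightarrow> tau_poly r n = tau_poly r' n"
  by (simp add: tau_poly_def)

lemma eta_poly_eq_tau_poly: "eta_poly d r = tau_poly (\<lambda>j. r (d - j))"
  by (simp add: fun_eq_iff eta_poly_def tau_poly_def)

lemma eta_poly_reversed: "n \<le> d \<Longrightarrow> eta_poly d (\<lambda>j. r (d - j)) n = tau_poly r n"
  unfolding eta_poly_eq_tau_poly by (rule tau_poly_cong) simp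

lemma poly_tau_poly: "poly (tau_poly r n) x = (\<Prod>j<n. x - r j)"
  by (simp add: tau_poly_def poly_prod)

context assoc_algebra
begin

lemma eval_poly_eq_sum:
  assumes "degree p \<le> N"
  shows "eval_poly scale p X = (\<Sum>k\<le>N. scale (coeff p k) (X ^ k))"
  unfolding eval_poly_def
  by (rule sum.mono_neutral_left) (use assms in \<open>auto simp: coeff_eq_0\<close>)

text \<open>
  Evaluation at a fixed element is multiplicative; multiplying by one linear factor at a time suffices
  for \<open>\<tau>\<^sub>n\<close> and \<open>\<eta>\<^sub>n\<close>.
\<close>

lemma eval_poly_mult_linear_factor:
  "eval_poly scale (p * [:- c, 1:]) X = X * eval_poly scale p X - scale c (eval_poly scale p X)"
proof -
  let ?n = "degree p"
  have p: "p * [:- c, 1:] = pCons 0 p - Polynomial.smult c p" by simp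
  have "degree (p * [:- c, 1:]) \<le> Suc ?n"
    using degree_mult_le[of p "[:- c, 1:]"] by simp
  then have "eval_poly scale (p * [:- c, 1:]) X =
      (\<Sum>k\<le>Suc ?n. scale (coeff (pCons 0 p) k) (X ^ k)) - (\<Sum>k\<le>Suc ?n. scale (c * coeff p k) (X ^ k))"
    unfolding p by (simp add: eval_poly_eq_sum scale_left_diff_distrib sum_subtractf del: sum.atMost_Suc)
  also have "(\<Sum>k\<le>Suc ?n. scale (coeff (pCons 0 p) k) (X ^ k)) = X * eval_poly scale p X"
    by (simp add: sum.atMost_Suc_shift eval_poly_def sum_distrib_left scale_mult_right del: sum.atMost_Suc)
  also have "(\<Sum>k\<le>Suc ?n. scale (c * coeff p k) (X ^ k)) = scale c (eval_poly scale p X)"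
    by (simp add: eval_poly_eq_sum[of p "Suc ?n"] scale_sum_right del: sum.atMost_Suc)
  finally show ?thesis .
qed

end

section \<open>From the algebra to operators on the module\<close>

context matrix_algebra_module
begin

lemma act_tau_poly:
  "act (eval_poly scale (tau_poly r n) X) v = shifted_product smult (act X) r n v"
proof (induction n)
  case 0
  show ?case by (simp add: tau_poly_def eval_poly_def act_one)
next
  case (Suc n)
  have "tau_poly r (Suc n) = tau_poly r n * [:- r n, 1:]"
    unfolding tau_poly_def by (rule prod.lessThan_Suc)
  then show ?case
    using Suc by (simp only: eval_poly_mult_linear_factor act_diff_left act_mult act_scale shifted_product.simps)
qed

lemma proj_zero_on_sum_of_ranges:
  assumes "eigen_resolution smult (act X) d (\<lambda>i. act (P i)) \<theta>"
    and "x \<in> (\<Sum>j\<in>J. range (act (P j)))" "J \<subseteq> {..d}" "k \<le> d" "k \<notin> J"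
  shows "act (P k) x = 0"
proof -
  interpret p: eigen_resolution smult "act X" d "\<lambda>i. act (P i)" \<theta> by fact
  have "finite J" using assms(3) finite_subset by blast
  then obtain y where y: "x = sum y J" "\<And>j. j \<in> J \<Longrightarrow> y j \<in> range (act (P j))"
    using assms(2) by (auto simp: set_sum_alt)
  have "act (P k) (y j) = 0" if j: "j \<in> J" for j
  proof -
    obtain z where "y j = act (P j) z" using y(2)[OF j] by blast
    then show ?thesis using p.proj_proj[of k j z] assms(3-5) j by auto
  qed
  then show ?thesis unfolding y(1) act_sum_right by simp
qed

text \<open>
  Vanishing of \<open>E\<^sub>i A* E\<^sub>j\<close> passes to the module trivially. That it is nonzero passes because the module
  is faithful: some vector is not killed by \<open>E\<^sub>i A* E\<^sub>j\<close>, and as \<open>E\<^sub>jV\<close> is a line, the same holds for all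
  vectors that \<open>E\<^sub>j\<close> does not kill.
\<close>

lemma leonard_action_of_leonard_system:
  assumes "leonard_system scale d act A E As Es"
    and "idempotent_ordering scale d act A E \<theta>" "idempotent_ordering scale d act As Es \<theta>s"
  shows "leonard_action smult d (act A) (\<lambda>i. act (E i)) \<theta> (act As) (\<lambda>i. act (Es i)) \<theta>s"
proof -
  interpret a: eigen_resolution smult "act A" d "\<lambda>i. act (E i)" \<theta>
    by (rule eigen_resolution_of_idempotent_ordering) fact
  interpret s: eigen_resolution smult "act As" d "\<lambda>i. act (Es i)" \<theta>s
    by (rule eigen_resolution_of_idempotent_ordering) fact
  have zero: "act P (act Y (act Q x)) = 0" if "P * Y * Q = 0" for P Y Q x
    using that by (metis act_mult act_zero_left)
  have nonzero: "act P (act Y (act Q x)) \<noteq> 0"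
    if "P * Y * Q \<noteq> 0" and x: "act Q x \<noteq> 0"
      and one: "\<And>y. \<exists>c. act Q y = smult c (act Q x)" for P Y Q x
  proof
    assume 0: "act P (act Y (act Q x)) = 0"
    have "act (P * Y * Q) y = act 0 y" for y
    proof -
      obtain c where "act Q y = smult c (act Q x)" using one by blast
      then show ?thesis using 0 by (simp add: act_mult act_smult)
    qed
    then show False using faithful that(1) by blast
  qed
  show ?thesis
  proof unfold_locales
    fix i j x assume ij: "i \<le> d" "j \<le> d"
    have far: "\<bar>int i - int j\<bar> > 1" if "i + 1 < j \<or> j + 1 < i" using that by auto
    have near: "\<bar>int i - int j\<bar> = 1" if "i = j + 1 \<or> j = i + 1" using that by auto
    show "act (E i) (act As (act (E j) x)) = 0" if "i + 1 < j \<or> j + 1 < i"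
      using assms(1) ij far[OF that] by (intro zero) (simp add: leonard_system_def)
    show "act (Es i) (act A (act (Es j) x)) = 0" if "i + 1 < j \<or> j + 1 < i"
      using assms(1) ij far[OF that] by (intro zero) (simp add: leonard_system_def)
    show "act (E i) (act As (act (E j) x)) \<noteq> 0" if "i = j + 1 \<or> j = i + 1" "act (E j) x \<noteq> 0"
      using assms(1) ij near[OF that(1)] that(2)
      by (intro nonzero a.proj_rank_one) (simp_all add: leonard_system_def)
    show "act (Es i) (act A (act (Es j) x)) \<noteq> 0" if "i = j + 1 \<or> j = i + 1" "act (Es j) x \<noteq> 0"
      using assms(1) ij near[OF that(1)] that(2)
      by (intro nonzero s.proj_rank_one) (simp_all add: leonard_system_def)
  qed
qed

text \<open>
  One eigenvector in \<open>U\<^sub>i\<close> suffices, since \<open>U\<^sub>i\<close> is a line.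
\<close>

lemma split_scalars_of_first_split_sequence:
  assumes "leonard_action smult d (act A) (\<lambda>i. act (E i)) \<theta> (act As) (\<lambda>i. act (Es i)) \<theta>s"
    and "first_split_sequence scale d act A E \<theta> As Es \<theta>s \<phi>"
  shows "leonard_action.split_scalars smult d (act A) (\<lambda>i. act (E i)) \<theta>
    (act As) (\<lambda>i. act (Es i)) \<theta>s \<phi>"
proof -
  interpret leonard_action smult d "act A" "\<lambda>i. act (E i)" \<theta> "act As" "\<lambda>i. act (Es i)" \<theta>s by fact
  show ?thesis
  proof (rule split_scalars_from_eigenvectors)
    fix i assume i: "i \<in> {1..d}"
    then obtain x where x: "x \<in> split_space d act E Es i" "x \<noteq> 0"
      and eq: "act ((A - scale (\<theta> (i - 1)) 1) * (As - scale (\<theta>s i) 1)) x = act (scale (\<phi> i) 1) x"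
      using assms(2) unfolding first_split_sequence_def eigenvalue_on_def by blast
    have "in_split i x"
      unfolding in_split_def
    proof safe
      fix j assume j: "j \<le> d"
      show "act (Es j) x = 0" if "i < j"
        by (rule proj_zero_on_sum_of_ranges[OF s.eigen_resolution_axioms, of _ "{0..i}"])
          (use x i j that in \<open>auto simp: split_space_def\<close>)
      show "act (E j) x = 0" if "j < i"
        by (rule proj_zero_on_sum_of_ranges[OF a.eigen_resolution_axioms, of _ "{i..d}"])
          (use x i j that in \<open>auto simp: split_space_def\<close>)
    qed
    moreover have "act A (act As x - smult (\<theta>s i) x) - smult (\<theta> (i - 1)) (act As x - smult (\<theta>s i) x)
        = smult (\<phi> i) x"
      using eq by (simp add: act_mult act_diff_left act_scale act_one)
    ultimately show "\<exists>x. in_split i x \<and> x \<noteq> 0 \<and>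
        act A (act As x - smult (\<theta>s i) x) - smult (\<theta> (i - 1)) (act As x - smult (\<theta>s i) x)
        = smult (\<phi> i) x"
      using x(2) by blast
  qed
qed

section \<open>The eight identities\<close>

lemma split_identity:
  assumes "leonard_action smult d (act A) (\<lambda>i. act (E i)) \<theta> (act As) (\<lambda>i. act (Es i)) \<theta>s"
    and "leonard_action.split_scalars smult d (act A) (\<lambda>i. act (E i)) \<theta>
      (act As) (\<lambda>i. act (Es i)) \<theta>s \<phi>"
    and "i \<le> d"
  shows "eval_poly scale (tau_poly \<theta> i) A * Es 0 * E d =
      scale ((\<Prod>j\<in>{1..i}. \<phi> j) / poly (eta_poly d \<theta>s d) (\<theta>s 0))
        (eval_poly scale (eta_poly d \<theta>s (d - i)) As * E d)"
proof (rule faithful)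
  fix v
  interpret leonard_action smult d "act A" "\<lambda>i. act (E i)" \<theta> "act As" "\<lambda>i. act (Es i)" \<theta>s by fact
  define c where "c = poly (eta_poly d \<theta>s d) (\<theta>s 0)"
  have c: "c = (\<Prod>j<d. \<theta>s 0 - \<theta>s (d - j))"
    by (simp add: c_def eta_poly_eq_tau_poly poly_tau_poly)
  have "\<theta>s 0 \<noteq> \<theta>s (d - j)" if "j < d" for j
    using inj_onD[OF s.\<theta>_inj, of 0 "d - j"] that by auto
  then have "c \<noteq> 0" unfolding c by simp
  have "smult c (act (eval_poly scale (tau_poly \<theta> i) A * Es 0 * E d) v) =
      smult (\<Prod>j\<in>{1..i}. \<phi> j) (act (eval_poly scale (eta_poly d \<theta>s (d - i)) As * E d) v)"
    using shifted_product_split[OF assms(2,3), of v]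
    by (simp add: c act_mult act_tau_poly eta_poly_eq_tau_poly)
  then have "smult (1 / c) (smult c (act (eval_poly scale (tau_poly \<theta> i) A * Es 0 * E d) v)) =
      smult (1 / c) (smult (\<Prod>j\<in>{1..i}. \<phi> j)
        (act (eval_poly scale (eta_poly d \<theta>s (d - i)) As * E d) v))"
    by (rule arg_cong)
  then show "act (eval_poly scale (tau_poly \<theta> i) A * Es 0 * E d) v =
      act (scale ((\<Prod>j\<in>{1..i}. \<phi> j) / poly (eta_poly d \<theta>s d) (\<theta>s 0))
        (eval_poly scale (eta_poly d \<theta>s (d - i)) As * E d)) v"
    using \<open>c \<noteq> 0\<close> unfolding c_def[symmetric] act_scale by simp
qed

end

lemma prod_reversed:
  fixes i d :: nat
  assumes "i \<le> d"
  shows "(\<Prod>j\<in>{1..i}. f (d - j + 1)) = (\<Prod>j\<in>{d - i + 1..d}. f j)"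
    and "(\<Prod>j\<in>{d - i + 1..d}. f (d - j + 1)) = (\<Prod>j\<in>{1..i}. f j)"
  by (rule prod.reindex_bij_witness[where i = "\<lambda>j. d - j + 1" and j = "\<lambda>j. d - j + 1"];
    use assms in force)+

text \<open>
  The second equation is the first for the system with both orders reversed and \<open>A\<close> exchanged with
  \<open>A*\<close>.
\<close>

lemma (in matrix_algebra_module) split_identity_pair:
  assumes L: "leonard_action smult d (act A) (\<lambda>i. act (E i)) \<theta> (act As) (\<lambda>i. act (Es i)) \<theta>s"
    and S: "leonard_action.split_scalars smult d (act A) (\<lambda>i. act (E i)) \<theta>
      (act As) (\<lambda>i. act (Es i)) \<theta>s \<phi>"
    and i: "i \<le> d"
  shows "eval_poly scale (tau_poly \<theta> i) A * Es 0 * E d =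
      scale ((\<Prod>j\<in>{1..i}. \<phi> j) / poly (eta_poly d \<theta>s d) (\<theta>s 0))
        (eval_poly scale (eta_poly d \<theta>s (d - i)) As * E d)"
    and "eval_poly scale (eta_poly d \<theta>s i) As * E d * Es 0 =
      scale ((\<Prod>j\<in>{d - i + 1..d}. \<phi> j) / poly (tau_poly \<theta> d) (\<theta> d))
        (eval_poly scale (tau_poly \<theta> (d - i)) A * Es 0)"
proof -
  show "eval_poly scale (tau_poly \<theta> i) A * Es 0 * E d =
      scale ((\<Prod>j\<in>{1..i}. \<phi> j) / poly (eta_poly d \<theta>s d) (\<theta>s 0))
        (eval_poly scale (eta_poly d \<theta>s (d - i)) As * E d)"
    by (rule split_identity[OF assms])
  show "eval_poly scale (eta_poly d \<theta>s i) As * E d * Es 0 =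
      scale ((\<Prod>j\<in>{d - i + 1..d}. \<phi> j) / poly (tau_poly \<theta> d) (\<theta> d))
        (eval_poly scale (tau_poly \<theta> (d - i)) A * Es 0)"
    using split_identity[of As "\<lambda>i. Es (d - i)" "\<lambda>i. \<theta>s (d - i)" A "\<lambda>i. E (d - i)" "\<lambda>i. \<theta> (d - i)",
      OF leonard_action.starred_reversed[OF L] leonard_action.split_scalars_dual[OF L S] i] i
    by (simp add: prod_reversed[OF i, of \<phi>, simplified] eta_poly_reversed)
      (simp add: eta_poly_eq_tau_poly)
qed

theorem theorem5p2:
  fixes scale :: "'k::field \<Rightarrow> 'a::ring_1 \<Rightarrow> 'a"
    and d i :: nat
    and act :: "'a \<Rightarrow> 'v::ab_group_add \<Rightarrow> 'v"
    and A As :: 'a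
    and E Es :: "nat \<Rightarrow> 'a"
    and \<theta> \<theta>s vphi phi :: "nat \<Rightarrow> 'k"
  assumes "matrix_algebra scale d"
    and "simple_left_module act"
    and "leonard_system scale d act A E As Es"
    and "parameter_array scale d act A E As Es \<theta> \<theta>s vphi phi"
    and "i \<le> d"
  shows "(eval_poly scale (eta_poly d \<theta> i) A * Es 0 * E 0 =
           scale ((\<Prod>j\<in>{1..i}. phi j) / poly (eta_poly d \<theta>s d) (\<theta>s 0))
             (eval_poly scale (eta_poly d \<theta>s (d - i)) As * E 0)) \<and>
    (eval_poly scale (eta_poly d \<theta> i) A * Es d * E 0 =
           scale ((\<Prod>j\<in>{d - i + 1..d}. vphi j) / poly (tau_poly \<theta>s d) (\<theta>s d))
             (eval_poly scale (tau_poly \<theta>s (d - i)) As * E 0)) \<and>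
    (eval_poly scale (tau_poly \<theta> i) A * Es 0 * E d =
           scale ((\<Prod>j\<in>{1..i}. vphi j) / poly (eta_poly d \<theta>s d) (\<theta>s 0))
             (eval_poly scale (eta_poly d \<theta>s (d - i)) As * E d)) \<and>
    (eval_poly scale (tau_poly \<theta> i) A * Es d * E d =
           scale ((\<Prod>j\<in>{d - i + 1..d}. phi j) / poly (tau_poly \<theta>s d) (\<theta>s d))
             (eval_poly scale (tau_poly \<theta>s (d - i)) As * E d)) \<and>
    (eval_poly scale (eta_poly d \<theta>s i) As * E 0 * Es 0 =
           scale ((\<Prod>j\<in>{d - i + 1..d}. phi j) / poly (eta_poly d \<theta> d) (\<theta> 0))
             (eval_poly scale (eta_poly d \<theta> (d - i)) A * Es 0)) \<and>
    (eval_poly scale (eta_poly d \<theta>s i) As * E d * Es 0 =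
           scale ((\<Prod>j\<in>{d - i + 1..d}. vphi j) / poly (tau_poly \<theta> d) (\<theta> d))
             (eval_poly scale (tau_poly \<theta> (d - i)) A * Es 0)) \<and>
    (eval_poly scale (tau_poly \<theta>s i) As * E 0 * Es d =
           scale ((\<Prod>j\<in>{1..i}. vphi j) / poly (eta_poly d \<theta> d) (\<theta> 0))
             (eval_poly scale (eta_poly d \<theta> (d - i)) A * Es d)) \<and>
    (eval_poly scale (tau_poly \<theta>s i) As * E d * Es d =
           scale ((\<Prod>j\<in>{1..i}. phi j) / poly (tau_poly \<theta> d) (\<theta> d))
             (eval_poly scale (tau_poly \<theta> (d - i)) A * Es d))"
proof -
  interpret matrix_algebra_module scale d act
    by (rule matrix_algebra_module.intro) fact+
  note i = assms(5)
  have L: "leonard_action smult d (act A) (\<lambda>i. act (E i)) \<theta> (act As) (\<lambda>i. act (Es i)) \<theta>s"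
    by (rule leonard_action_of_leonard_system)
      (use assms(3,4) in \<open>auto simp: parameter_array_def\<close>)
  note Lr = leonard_action.reversed[OF L]
  have S: "leonard_action.split_scalars smult d (act A) (\<lambda>i. act (E i)) \<theta>
      (act As) (\<lambda>i. act (Es i)) \<theta>s vphi"
    by (rule split_scalars_of_first_split_sequence[OF L])
      (use assms(4) in \<open>simp add: parameter_array_def\<close>)
  have Sr: "leonard_action.split_scalars smult d (act A) (\<lambda>i. act (E (d - i))) (\<lambda>i. \<theta> (d - i))
      (act As) (\<lambda>i. act (Es i)) \<theta>s phi"
    by (rule split_scalars_of_first_split_sequence[OF Lr])
      (use assms(4) in \<open>simp add: parameter_array_def\<close>)
  \<comment> \<open>Each of the four systems, with the \<open>E\<^sub>i\<close> and the \<open>E*\<^sub>i\<close> in the given or in the opposite order,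
    contributes two of the identities. Going to the opposite order of the \<open>E*\<^sub>i\<close> is done by reversing both
    orders, which is why a double reversal of the \<open>E\<^sub>i\<close> occurs in the last case.\<close>
  note pair = split_identity_pair[OF L S i]
  note pair_r = split_identity_pair[of A "\<lambda>i. E (d - i)", OF Lr Sr i]
  note pair_b = split_identity_pair[of A "\<lambda>i. E (d - i)" _ As "\<lambda>i. Es (d - i)",
    OF leonard_action.both_reversed[OF L] leonard_action.split_scalars_both_reversed[OF L S] i]
  note pair_rb = split_identity_pair[of A "\<lambda>i. E (d - (d - i))" _ As "\<lambda>i. Es (d - i)",
    OF leonard_action.both_reversed[OF Lr] leonard_action.split_scalars_both_reversed[OF Lr Sr] i]
  have \<theta>\<theta>: "n \<le> d \<Longrightarrow> tau_poly (\<lambda>j. \<theta> (d - (d - j))) n = tau_poly \<theta> n" for n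
    by (rule tau_poly_cong) simp
  note simps = eta_poly_reversed \<theta>\<theta> prod_reversed[OF i, simplified] eta_poly_eq_tau_poly[symmetric]
  show ?thesis
    using pair pair_r pair_b pair_rb i by (simp add: simps)
qed

end
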